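(* Let $G$ be a graph of order $n\ge 4$ such that both $G$ and its complement $\overline G$ are connected. Then: (1) $n\le \operatorname{th}_+(G)+\operatorname{th}_+(\overline G)\le 2n-o(n)$; for $n\ne 5$, $\max\{2n,3n-9\}\le \operatorname{th}_+(G)\cdot\operatorname{th}_+(\overline G)\le n^2-o(n^2)$; for $n=5$, $9\le \operatorname{th}_+(G)\cdot\operatorname{th}_+(\overline G)\le 12$. (2) $n-2\le \operatorname{th}_+^{\ast}(G)+\operatorname{th}_+^{\ast}(\overline G)\le 2n-o(n)$ and $\max\{n-1,2n-8\}\le \operatorname{th}_+^{\ast}(G)\cdot\operatorname{th}_+^{\ast}(\overline G)\le n^2-o(n^2)$. (3) $n\le \operatorname{th}_+^{\times}(G)+\operatorname{th}_+^{\times}(\overline G)\le 2n$; for $n\ge 6$, $3n\le \operatorname{th}_+^{\times}(G)\cdot\operatorname{th}_+^{\times}(\overline G)\le n^2$; for $n=4$, $\operatorname{th}_+^{\times}(G)\cdot\operatorname{th}_+^{\times}(\overline G)=9$; and for $n=5$, $12\le \operatorname{th}_+^{\times}(G)\cdot\operatorname{th}_+^{\times}(\overline G)\le 20$. For (1) and (2), the upper bounds (sum and product) are tight and the lower bounds (sum and product) are almost sharp. For (3), the upper bounds (sum and product) and the product lower bound are sharp, and the sum lower bound is almost sharp.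
   Context: Graphs are finite, simple, undirected, with nonempty vertex set; the order of $G$ is $|V(G)|$; $\overline G$ is the complement of $G$. PSD forcing: each vertex is filled or unfilled. PSD color change rule: let $B$ be the set of currently filled vertices and let $W_1,\dots,W_k$ be the vertex sets of the components of $G[V(G)\setminus B]$; if $v\in B$, $w\in W_i$, and $w$ is the only unfilled neighbor of $v$ in $G[W_i\cup B]$, then fill $w$. For $B\subseteq V(G)$ put $B^{[0]}=B$, and let $B^{[i+1]}$ be $B^{[i]}$ together with all vertices that can be filled by one application of the rule when exactly the vertices of $B^{[i]}$ are filled. $\operatorname{pt}_+(G;B)$ is the least $t$ with $B^{[t]}=V(G)$ ($\infty$ if none exists), and $\operatorname{pt}_+(G,k)=\min_{|B|=k}\operatorname{pt}_+(G;B)$. For $G$ of order $n$: $\operatorname{th}_+(G)=\min_{1\le k\le n}(k+\operatorname{pt}_+(G,k))$; $\operatorname{th}_+^{\times}(G)=\min_{1\le k\le n}k(1+\operatorname{pt}_+(G,k))$; and, if $G$ has an edge, $\operatorname{th}_+^{\ast}(G)=\min_{1\le k\le n-1}k\cdot\operatorname{pt}_+(G,k)$. Asymptotic notation: $f$ is $o(g)$ if $f,g$ are positive real valued functions of $n$ with $f(n)/g(n)\to0$ as $n\to\infty$. An upper bound $b(n)-o(b(n))$ means an upper bound $b(n)-f(n)$ for some function $f$ that is $o(b)$, valid for all graphs in the class. Here all graphs are in the class with $G,\overline G$ both connected. A bound $b(n)$ on $\zeta(G)+\zeta(\overline G)$ (or $\zeta(G)\cdot\zeta(\overline G)$) is sharp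 if it is attained by infinitely many graphs $G$ in the class; it is almost sharp if, for some positive integer $k<10$, infinitely many $G$ in the class satisfy $\zeta(G)+\zeta(\overline G)=b(n)\pm k$ (respectively with the product). A bound $b(n)\pm o(b(n))$ is tight if infinitely many $G$ in the class satisfy $\zeta(G)+\zeta(\overline G)=b(n)\pm o(b(n))$ (respectively with the product). *)

theory Defs
  imports "Graph_Theory.Graph_Theory" "HOL-Library.Landau_Symbols"
begin

section \<open>Graphs\<close>

text \<open>A finite simple undirected graph is a \<^locale>\<open>pair_graph\<close> (finite, loopless, with a symmetric
  set of arcs); an edge is a pair of opposite arcs.\<close>

definition graph_order :: "'a pair_pre_digraph \<Rightarrow> nat" where
  "graph_order G = card (pverts G)"

definition complement :: "'a pair_pre_digraph \<Rightarrow> 'a pair_pre_digraph" where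
  "complement G = \<lparr> pverts = pverts G,
     parcs = {(u, v). u \<in> pverts G \<and> v \<in> pverts G \<and> u \<noteq> v \<and> (u, v) \<notin> parcs G} \<rparr>"

definition co_connected :: "'a pair_pre_digraph \<Rightarrow> bool" where
  "co_connected G \<longleftrightarrow> pair_graph G \<and>
     Digraph_Component.connected (with_proj G) \<and>
     Digraph_Component.connected (with_proj (complement G))"

text \<open>The arcs being symmetric, strongly connected components are the connected components.\<close>

definition component_sets :: "'a pair_pre_digraph \<Rightarrow> 'a set \<Rightarrow> 'a set set" where
  "component_sets G U = verts ` pre_digraph.sccs (with_proj G \<restriction> U)"


section \<open>PSD forcing\<close>

definition psd_forces :: "'a pair_pre_digraph \<Rightarrow> 'a set \<Rightarrow> 'a \<Rightarrow> 'a \<Rightarrow> bool" where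
  "psd_forces G B v w \<longleftrightarrow> v \<in> B \<and>
     (\<exists>W \<in> component_sets G (pverts G - B). w \<in> W \<and>
        {u \<in> pverts G - B. (v, u) \<in> arcs (with_proj G \<restriction> (W \<union> B))} = {w})"

definition psd_step :: "'a pair_pre_digraph \<Rightarrow> 'a set \<Rightarrow> 'a set" where
  "psd_step G B = B \<union> {w. \<exists>v. psd_forces G B v w}"

text \<open>The infimum of the empty set in \<^typ>\<open>enat\<close> is \<open>\<infinity>\<close>.\<close>

definition psd_pt_set :: "'a pair_pre_digraph \<Rightarrow> 'a set \<Rightarrow> enat" where
  "psd_pt_set G B = (INF t \<in> {t. (psd_step G ^^ t) B = pverts G}. enat t)"

definition psd_pt :: "'a pair_pre_digraph \<Rightarrow> nat \<Rightarrow> enat" where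
  "psd_pt G k = (MIN B \<in> {B. B \<subseteq> pverts G \<and> card B = k}. psd_pt_set G B)"


section \<open>Throttling numbers\<close>

text \<open>The minima are finite for every nonempty graph (with an edge in the case of \<open>th_star\<close>), so
  \<^const>\<open>the_enat\<close> only changes the type; see the lemmas \<open>enat_th_plus\<close>, \<open>enat_th_times\<close> and
  \<open>enat_th_star\<close>.\<close>

definition th_plus :: "'a pair_pre_digraph \<Rightarrow> nat" where
  "th_plus G = the_enat (MIN k \<in> {1..graph_order G}. enat k + psd_pt G k)"

definition th_times :: "'a pair_pre_digraph \<Rightarrow> nat" where
  "th_times G = the_enat (MIN k \<in> {1..graph_order G}. enat k * (1 + psd_pt G k))"

definition th_star :: "'a pair_pre_digraph \<Rightarrow> nat" where
  "th_star G = the_enat (MIN k \<in> {1..graph_order G - 1}. enat k * psd_pt G k)"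

lemma psd_pt_le:
  assumes "finite (pverts G)" "B \<subseteq> pverts G" "(psd_step G ^^ t) B = pverts G"
  shows "psd_pt G (card B) \<le> enat t"
proof -
  have "finite {C. C \<subseteq> pverts G \<and> card C = card B}"
    using assms(1) by simp
  then have "psd_pt G (card B) \<le> psd_pt_set G B"
    unfolding psd_pt_def using assms(2) by (intro Min_le) auto
  also have "\<dots> \<le> enat t"
    unfolding psd_pt_set_def using assms(3) by (intro INF_lower) auto
  finally show ?thesis .
qed

lemma psd_pt_order:
  assumes "finite (pverts G)"
  shows "psd_pt G (graph_order G) = 0"
proof -
  have "psd_pt G (card (pverts G)) \<le> enat 0"
    using assms by (intro psd_pt_le) auto
  then show ?thesis
    by (simp add: graph_order_def zero_enat_def[symmetric])
qed

lemma enat_the_Min: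
  assumes "finite K" "k \<in> K" "f k \<noteq> (\<infinity> :: enat)"
  shows "enat (the_enat (MIN k \<in> K. f k)) = (MIN k \<in> K. f k)"
proof -
  have "(MIN k \<in> K. f k) \<le> f k"
    using assms by (intro Min_le) auto
  then have "(MIN k \<in> K. f k) \<noteq> \<infinity>"
    using assms(3) by (metis enat_ord_simps(5))
  then show ?thesis
    by auto
qed

lemma enat_th_plus:
  assumes "finite (pverts G)" "pverts G \<noteq> {}"
  shows "enat (th_plus G) = (MIN k \<in> {1..graph_order G}. enat k + psd_pt G k)"
  unfolding th_plus_def
  using psd_pt_order[OF assms(1)] assms
  by (intro enat_the_Min[where k = "graph_order G"])
     (auto simp: graph_order_def Suc_le_eq card_gt_0_iff)

lemma enat_th_times:
  assumes "finite (pverts G)" "pverts G \<noteq> {}"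
  shows "enat (th_times G) = (MIN k \<in> {1..graph_order G}. enat k * (1 + psd_pt G k))"
  unfolding th_times_def
  using psd_pt_order[OF assms(1)] assms
  by (intro enat_the_Min[where k = "graph_order G"])
     (auto simp: graph_order_def Suc_le_eq card_gt_0_iff)

lemma enat_th_star:
  assumes "pair_graph G" "parcs G \<noteq> {}"
  shows "enat (th_star G) = (MIN k \<in> {1..graph_order G - 1}. enat k * psd_pt G k)"
proof -
  interpret pair_graph G by fact
  obtain v u where vu: "(v, u) \<in> parcs G"
    using assms(2) by auto
  have in_V: "u \<in> pverts G" "v \<in> pverts G" and ne: "v \<noteq> u"
    using vu in_arcsD1 in_arcsD2 no_loops' by auto
  define B where "B = pverts G - {u}"
  define H where "H = with_proj G \<restriction> {u}"
  have VB: "pverts G - B = {u}"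
    using in_V by (auto simp: B_def)
  have "H \<in> pre_digraph.sccs H"
  proof (rule pre_digraph.in_sccsI)
    have "wf_digraph H"
      unfolding H_def by unfold_locales (auto simp: induce_subgraph_def)
    then show "induced_subgraph H H"
      by (auto simp: induced_subgraph_def subgraph_def compatible_def wf_digraph.wellformed
        intro: wf_digraph.wellformed)
    show "strongly_connected H"
      by (rule strongly_connectedI)
        (auto simp: H_def reachable_def intro: rtrancl_on_refl)
    show "\<not> (\<exists>c'. induced_subgraph c' H \<and> strongly_connected c' \<and> verts H \<subset> verts c')"
      by (auto dest!: induced_imp_subgraph subgraph_imp_subverts)
  qed
  then have comp: "{u} \<in> component_sets G (pverts G - B)"
    unfolding VB component_sets_def by (force simp: H_def)
  have "psd_forces G B v u"
    unfolding psd_forces_def using comp vu in_V ne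
    by (intro conjI bexI[where x = "{u}"]) (auto simp: B_def)
  moreover have "w \<in> pverts G" if "psd_forces G B v' w" for v' w
    using that unfolding psd_forces_def by blast
  ultimately have "(psd_step G ^^ 1) B = pverts G"
    using in_V by (auto simp: psd_step_def B_def)
  moreover have "card B = graph_order G - 1"
    using in_V by (simp add: B_def graph_order_def)
  ultimately have "psd_pt G (graph_order G - 1) \<le> enat 1"
    using psd_pt_le[of G B 1] finite_verts by (auto simp: B_def)
  then have "psd_pt G (graph_order G - 1) \<noteq> \<infinity>"
    by (metis enat_ord_simps(5) enat.distinct(1))
  moreover have "card {u, v} \<le> graph_order G"
    unfolding graph_order_def using in_V finite_verts by (intro card_mono) auto
  ultimately show ?thesis
    unfolding th_star_def using ne
    by (intro enat_the_Min[where k = "graph_order G - 1"])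
       (auto simp: imult_is_infinity)
qed


section \<open>Nordhaus-Gaddum sums and products\<close>

definition ng_sum :: "('a pair_pre_digraph \<Rightarrow> nat) \<Rightarrow> 'a pair_pre_digraph \<Rightarrow> nat" where
  "ng_sum \<zeta> G = \<zeta> G + \<zeta> (complement G)"

definition ng_prod :: "('a pair_pre_digraph \<Rightarrow> nat) \<Rightarrow> 'a pair_pre_digraph \<Rightarrow> nat" where
  "ng_prod \<zeta> G = \<zeta> G * \<zeta> (complement G)"

definition is_little_o :: "(nat \<Rightarrow> real) \<Rightarrow> (nat \<Rightarrow> real) \<Rightarrow> bool" where
  "is_little_o f g \<longleftrightarrow> (\<forall>n\<ge>1. 0 < f n \<and> 0 < g n) \<and> f \<in> o(g)"

text \<open>Infinitely many graphs means infinitely many isomorphism classes. Every finite graph is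
  isomorphic to one whose vertices are natural numbers.\<close>

definition infinitely_many_graphs :: "(nat pair_pre_digraph \<Rightarrow> bool) \<Rightarrow> bool" where
  "infinitely_many_graphs P \<longleftrightarrow>
     (\<exists>S. infinite S \<and> (\<forall>G\<in>S. P G) \<and>
        (\<forall>G\<in>S. \<forall>H\<in>S. G \<noteq> H \<longrightarrow> \<not> digraph_iso (with_proj G) (with_proj H)))"

text \<open>In the following definitions \<open>Z\<close> is a sum \<^term>\<open>ng_sum \<zeta>\<close> or a product \<^term>\<open>ng_prod \<zeta>\<close>.\<close>

definition sharp :: "(nat pair_pre_digraph \<Rightarrow> nat) \<Rightarrow> (nat \<Rightarrow> int) \<Rightarrow> bool" where
  "sharp Z b \<longleftrightarrow>
     infinitely_many_graphs (\<lambda>G. co_connected G \<and> int (Z G) = b (graph_order G))"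

definition almost_sharp :: "(nat pair_pre_digraph \<Rightarrow> nat) \<Rightarrow> (nat \<Rightarrow> int) \<Rightarrow> bool" where
  "almost_sharp Z b \<longleftrightarrow> (\<exists>k::int. 0 < k \<and> k < 10 \<and>
     infinitely_many_graphs (\<lambda>G. co_connected G \<and>
       (int (Z G) = b (graph_order G) + k \<or> int (Z G) = b (graph_order G) - k)))"

text \<open>Tightness of an upper bound \<open>b(n) - o(b(n))\<close>.\<close>

definition tight_minus_o :: "(nat pair_pre_digraph \<Rightarrow> nat) \<Rightarrow> (nat \<Rightarrow> real) \<Rightarrow> bool" where
  "tight_minus_o Z b \<longleftrightarrow> (\<exists>f. is_little_o f b \<and>
     infinitely_many_graphs (\<lambda>G. co_connected G \<and>
       real (Z G) = b (graph_order G) - f (graph_order G)))"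

end

theory Submission
  imports Defs "HOL-Analysis.Convex" "HOL-Computational_Algebra.Primes" "HOL-Real_Asymp.Real_Asymp"
begin

text \<open>A forcing set of size \<open>k\<close> yields a chordal completion of \<open>G\<close> with clique number at most
  \<open>k + 1\<close>. The non-edges of the completion form a bramble of the complement: two of them that do not
  touch would span an induced 4-cycle. A set hitting this bramble leaves a clique of the completion,
  and forcing sets have at least the order of a bramble minus one elements, so forcing sets of \<open>G\<close>
  and of its complement together have at least \<open>n - 2\<close> elements. If \<open>k\<close> vertices fill \<open>G\<close> in one
  step, the other vertices have degree at most \<open>k\<close>, which excludes the small exceptional values of
  the products. The lower bounds are nearly attained by a star with one edge extended. For the upper
  bounds, polarity graphs over the integers modulo a prime have no 4-cycle and, by double counting,
  no two large sets without an edge in between, so forcing sets of such a graph and of its complement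
  contain almost all vertices.\<close>

section \<open>Graphs, components and forcing sets\<close>

text \<open>Each throttling number is a minimum over pairs (\<open>k\<close>, \<open>t\<close>) with
  \<open>fills_in G k t\<close>, which only asserts that \<open>t\<close> rounds suffice. Hence the
  lower bounds come down to arithmetic with a pair for \<open>G\<close> and a pair
  (\<open>l\<close>, \<open>s\<close>) for the complement. Forcing sets alone give
  \<open>n \<le> k + l + 2\<close>; the rest uses three more facts: zero rounds mean
  \<open>k = n\<close>, one vertex never fills in one round (no vertex dominates), and
  \<open>k = 2\<close>, \<open>l = n - 4\<close> are never both one-round. The upper bounds special
  to orders 4 and 5 rest on an induced path on four vertices, present because \<open>G\<close> and
  its complement are both connected. In the general upper bounds the terms o(n) and o(n^2) can be
  the constant 1, since two nonadjacent vertices can always be left unfilled; tightness is the hard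
  direction. On \<open>p * p\<close> points, sets of about \<open>p * sqrt p\<close> points are
  large enough for the double count, so forcing sets miss only on the order of n^(3/4)
  vertices.\<close>

definition fills_in :: "'a pair_pre_digraph \<Rightarrow> nat \<Rightarrow> nat \<Rightarrow> bool" where
  "fills_in G k t \<longleftrightarrow> (\<exists>B \<subseteq> pverts G. card B = k \<and> (psd_step G ^^ t) B = pverts G)"

section \<open>Components as reachability classes\<close>

lemma (in pair_graph) rtrancl_on_sym:
  "(u, v) \<in> rtrancl_on U (parcs G) \<longleftrightarrow> (v, u) \<in> rtrancl_on U (parcs G)"
proof -
  have "sym (parcs G)" using arcs_symmetric by (auto intro: symI)
  then have "sym (rtrancl_on U (parcs G))" by (rule Rtrancl_On.rtrancl_on_sym)
  then show ?thesis by (auto dest: symD)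
qed

text \<open>Arcs are symmetric, so mutual reachability is just reachability. Restricting the
  vertices by \<open>rtrancl_on U\<close> already restricts the arcs, so no induced subgraph has to
  be formed.\<close>

lemma (in pair_graph) component_sets_eq:
  "component_sets G U = (\<lambda>w. {u. (w, u) \<in> rtrancl_on U (parcs G)}) ` U"
proof -
  interpret H: wf_digraph "with_proj G \<restriction> U"
    by unfold_locales auto
  have *: "(u, v) \<in> rtrancl_on U (parcs G \<inter> U \<times> U)" if "(u, v) \<in> rtrancl_on U (parcs G)" for u v
    using that by (induction rule: rtrancl_on_induct) (auto intro: rtrancl_on_into_rtrancl_on)
  have arcs: "arcs_ends (with_proj G \<restriction> U) = parcs G \<inter> U \<times> U"
    by (auto simp: arcs_ends_def arc_to_ends_def)
  have "(u, v) \<in> rtrancl_on U (parcs G \<inter> U \<times> U) \<longleftrightarrow> (u, v) \<in> rtrancl_on U (parcs G)" for u v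
    using * rtrancl_on_mono[of "parcs G \<inter> U \<times> U" "parcs G" U U] by blast
  then have reach: "reachable (with_proj G \<restriction> U) u v \<longleftrightarrow> (u, v) \<in> rtrancl_on U (parcs G)" for u v
    unfolding reachable_def arcs by simp
  have "component_sets G U = H.scc_of ` U"
    unfolding component_sets_def using H.sccs_verts_conv H.sccs_verts_conv_scc_of by simp
  moreover have "H.scc_of = (\<lambda>w. {u. (w, u) \<in> rtrancl_on U (parcs G)})"
    unfolding H.scc_of_def reach using rtrancl_on_sym by blast
  ultimately show ?thesis by simp
qed

text \<open>A component containing \<open>w\<close> is the reachability class of \<open>w\<close>,
  so the quantifier over components disappears.\<close>

lemma (in pair_graph) psd_forces_iff:
  "psd_forces G B v w \<longleftrightarrow> v \<in> B \<and> w \<in> pverts G - B \<and> (v, w) \<in> parcs G \<and>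
     (\<forall>u. (w, u) \<in> rtrancl_on (pverts G - B) (parcs G) \<longrightarrow> (v, u) \<in> parcs G \<longrightarrow> u = w)"
  (is "?L \<longleftrightarrow> ?R")
proof
  assume ?L
  then obtain x where v: "v \<in> B" and x: "x \<in> pverts G - B"
    and w: "(x, w) \<in> rtrancl_on (pverts G - B) (parcs G)"
    and eq: "{u \<in> pverts G - B. (v, u) \<in> arcs (with_proj G \<restriction> 
        ({u. (x, u) \<in> rtrancl_on (pverts G - B) (parcs G)} \<union> B))} = {w}"
    unfolding psd_forces_def component_sets_eq by auto
  have "u = w" if "(w, u) \<in> rtrancl_on (pverts G - B) (parcs G)" "(v, u) \<in> parcs G" for u
  proof -
    have "(x, u) \<in> rtrancl_on (pverts G - B) (parcs G)"
      using w that(1) by (rule rtrancl_on_trans)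
    moreover have "u \<in> pverts G - B" using that(1) by (rule in_rtrancl_on_in_F)
    ultimately have "u \<in> {w}"
      unfolding eq[symmetric] using that(2) v by auto
    then show ?thesis by simp
  qed
  moreover have "w \<in> pverts G - B" using w by (rule in_rtrancl_on_in_F)
  ultimately show ?R using v eq by auto
next
  assume R: ?R
  let ?W = "{u. (w, u) \<in> rtrancl_on (pverts G - B) (parcs G)}"
  have "{u \<in> pverts G - B. (v, u) \<in> arcs (with_proj G \<restriction> (?W \<union> B))} = {w}"
    using R by auto
  moreover have "w \<in> ?W" "?W \<in> component_sets G (pverts G - B)"
    unfolding component_sets_eq using R by auto
  moreover have "v \<in> B" using R by simp
  ultimately show ?L
    unfolding psd_forces_def by (intro conjI bexI[where x = ?W])
qed

lemma pair_graph_complement: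
  assumes "pair_graph G" shows "pair_graph (complement G)"
proof -
  interpret pair_graph G by fact
  have "finite (parcs (complement G))"
    by (rule finite_subset[of _ "pverts G \<times> pverts G"]) (auto simp: complement_def)
  then show ?thesis
    by unfold_locales (auto simp: complement_def symmetric_def sym_def dest: arcs_symmetric)
qed

lemma pverts_complement [simp]: "pverts (complement G) = pverts G"
  by (simp add: complement_def)

lemma graph_order_complement [simp]: "graph_order (complement G) = graph_order G"
  by (simp add: graph_order_def)

lemma in_parcs_complement [simp]:
  "(u, v) \<in> parcs (complement G) \<longleftrightarrow>
     u \<in> pverts G \<and> v \<in> pverts G \<and> u \<noteq> v \<and> (u, v) \<notin> parcs G"
  by (simp add: complement_def)

lemma complement_complement:
  assumes "pair_graph G" shows "complement (complement G) = G"
proof -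
  interpret pair_graph G by fact
  have "parcs (complement (complement G)) = parcs G"
    using in_arcsD1 in_arcsD2 no_loops' by auto
  then show ?thesis by (cases G) (auto simp: complement_def)
qed

lemma co_connected_complement:
  assumes "co_connected G" shows "co_connected (complement G)"
  using assms pair_graph_complement by (auto simp: co_connected_def complement_complement)

lemma (in pair_graph) parcs_symcl: "(parcs G)\<^sup>s = parcs G"
  using arcs_symmetric by (auto simp: symcl_def)

lemma connected_iff:
  assumes "pair_graph G"
  shows "Digraph_Component.connected (with_proj G) \<longleftrightarrow>
    pverts G \<noteq> {} \<and> (\<forall>u \<in> pverts G. \<forall>v \<in> pverts G. (u, v) \<in> rtrancl_on (pverts G) (parcs G))"
  using pair_graph.parcs_symcl[OF assms] by (simp add: connected_conv)

text \<open>A walk from inside \<open>A\<close> to outside has an arc that leaves \<open>A\<close>.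
  With \<open>co_connected_complement\<close> the same applies to the complement.\<close>

lemma co_connected_cut:
  assumes "co_connected G" "A \<subseteq> pverts G" "A \<noteq> {}" "A \<noteq> pverts G"
  obtains x y where "x \<in> A" "y \<in> pverts G - A" "(x, y) \<in> parcs G"
proof -
  obtain a b where ab: "a \<in> A" "b \<in> pverts G - A" using assms by blast
  have "(a, b) \<in> rtrancl_on (pverts G) (parcs G)"
    using assms(1,2) ab connected_iff unfolding co_connected_def by blast
  then have "b \<in> A \<or> (\<exists>x \<in> A. \<exists>y \<in> pverts G - A. (x, y) \<in> parcs G)"
    by (induction rule: rtrancl_on_induct) (use ab in auto)
  with ab that show ?thesis by auto
qed

section \<open>Attainment of the minima\<close>

lemma psd_pt_attained:
  assumes "finite (pverts G)" "k \<le> graph_order G" "psd_pt G k \<noteq> \<infinity>"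
  obtains t where "psd_pt G k = enat t" "fills_in G k t"
proof -
  let ?S = "{B. B \<subseteq> pverts G \<and> card B = k}"
  have "?S \<noteq> {}"
    using obtain_subset_with_card_n[of k "pverts G"] assms(2) unfolding graph_order_def by blast
  moreover have "finite ?S" using assms(1) by simp
  ultimately have "psd_pt G k \<in> psd_pt_set G ` ?S"
    unfolding psd_pt_def by (intro Min_in) auto
  then obtain B where B: "B \<subseteq> pverts G" "card B = k" "psd_pt G k = psd_pt_set G B" by auto
  let ?T = "{t. (psd_step G ^^ t) B = pverts G}"
  \<comment> \<open>An empty \<open>?T\<close> would have infimum infinity; a nonempty set of
    naturals attains its infimum.\<close>
  have "?T \<noteq> {}"
  proof
    assume "?T = {}"
    then have "psd_pt_set G B = \<infinity>" by (simp add: psd_pt_set_def top_enat_def)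
    with B assms(3) show False by simp
  qed
  then have "psd_pt_set G B \<in> enat ` ?T"
    unfolding psd_pt_set_def using wellorder_InfI[of _ "enat ` ?T"] by blast
  then show ?thesis using B that unfolding fills_in_def by auto
qed

lemma psd_pt_le_fills_in:
  assumes "finite (pverts G)" "fills_in G k t"
  shows "psd_pt G k \<le> enat t"
  using assms(2) psd_pt_le[OF assms(1), of _ t] unfolding fills_in_def by auto

lemma fills_in_le:
  assumes "finite (pverts G)" "fills_in G k t"
  shows "k \<le> graph_order G"
  using assms(2) card_mono[OF assms(1)] unfolding fills_in_def graph_order_def by auto

context
  fixes G :: "'a pair_pre_digraph"
  assumes fin: "finite (pverts G)" and ne: "pverts G \<noteq> {}"
begin

lemma graph_order_pos: "graph_order G \<ge> 1"
  using fin ne by (simp add: graph_order_def Suc_le_eq card_gt_0_iff)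

lemma th_plus_le:
  assumes "fills_in G k t" "k \<ge> 1" shows "th_plus G \<le> k + t"
proof -
  have "enat (th_plus G) \<le> enat k + psd_pt G k"
    unfolding enat_th_plus[OF fin ne] using assms fills_in_le[OF fin] by (intro Min_le) auto
  also have "\<dots> \<le> enat k + enat t"
    using psd_pt_le_fills_in[OF fin assms(1)] by (intro add_left_mono)
  finally show ?thesis by simp
qed

lemma th_times_le:
  assumes "fills_in G k t" "k \<ge> 1" shows "th_times G \<le> k * (1 + t)"
proof -
  have "enat (th_times G) \<le> enat k * (1 + psd_pt G k)"
    unfolding enat_th_times[OF fin ne] using assms fills_in_le[OF fin] by (intro Min_le) auto
  also have "\<dots> \<le> enat k * (1 + enat t)"
    using psd_pt_le_fills_in[OF fin assms(1)] by (intro mult_left_mono add_left_mono) auto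
  finally show ?thesis by (simp add: one_enat_def)
qed

lemma th_plus_attained:
  obtains k t where "1 \<le> k" "k \<le> graph_order G" "fills_in G k t" "th_plus G = k + t"
proof -
  have "enat (th_plus G) \<in> (\<lambda>k. enat k + psd_pt G k) ` {1..graph_order G}"
    unfolding enat_th_plus[OF fin ne] using graph_order_pos by (intro Min_in) auto
  then obtain k where k: "k \<in> {1..graph_order G}" "enat k + psd_pt G k = enat (th_plus G)"
    by auto
  have "psd_pt G k \<noteq> \<infinity>"
  proof
    assume "psd_pt G k = \<infinity>"
    with k show False by simp
  qed
  then obtain t where "psd_pt G k = enat t" "fills_in G k t"
    using psd_pt_attained[OF fin] k by auto
  moreover from this k have "th_plus G = k + t" by simp
  moreover from k have "1 \<le> k" "k \<le> graph_order G" by auto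
  ultimately show ?thesis using that by blast
qed

lemma th_times_attained:
  obtains k t where "1 \<le> k" "k \<le> graph_order G" "fills_in G k t" "th_times G = k * (1 + t)"
proof -
  have "enat (th_times G) \<in> (\<lambda>k. enat k * (1 + psd_pt G k)) ` {1..graph_order G}"
    unfolding enat_th_times[OF fin ne] using graph_order_pos by (intro Min_in) auto
  then obtain k where k: "k \<in> {1..graph_order G}" "enat k * (1 + psd_pt G k) = enat (th_times G)"
    by auto
  \<comment> \<open>As \<open>k\<close> is positive, an infinite time would make the product
    infinite; in \<open>enat\<close> only the factor 0 could prevent this.\<close>
  have "psd_pt G k \<noteq> \<infinity>"
  proof
    assume "psd_pt G k = \<infinity>"
    with k show False by (simp add: imult_is_infinity enat_0_iff)
  qed
  then obtain t where "psd_pt G k = enat t" "fills_in G k t"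
    using psd_pt_attained[OF fin] k by auto
  moreover from this k have "th_times G = k * (1 + t)" by (simp add: one_enat_def)
  moreover from k have "1 \<le> k" "k \<le> graph_order G" by auto
  ultimately show ?thesis using that by blast
qed

end

lemma th_star_le:
  assumes "pair_graph G" "parcs G \<noteq> {}" "fills_in G k t" "k \<ge> 1" "k < graph_order G"
  shows "th_star G \<le> k * t"
proof -
  interpret pair_graph G by fact
  have "enat (th_star G) \<le> enat k * psd_pt G k"
    unfolding enat_th_star[OF assms(1,2)] using assms by (intro Min_le) auto
  also have "\<dots> \<le> enat k * enat t"
    using psd_pt_le_fills_in[OF _ assms(3)] finite_verts by (intro mult_left_mono) auto
  finally show ?thesis by simp
qed

lemma th_star_attained:
  assumes "pair_graph G" "parcs G \<noteq> {}"
  obtains k t where "1 \<le> k" "k < graph_order G" "fills_in G k t" "th_star G = k * t"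
proof -
  interpret pair_graph G by fact
  obtain x y where xy: "(x, y) \<in> parcs G" using assms(2) by auto
  then have "card {x, y} \<le> graph_order G"
    unfolding graph_order_def using in_arcsD1 in_arcsD2 by (intro card_mono) auto
  then have "2 \<le> graph_order G" using no_loops'[OF xy] by auto
  then have *: "{1..graph_order G - 1} \<noteq> {}" by auto
  have "enat (th_star G) \<in> (\<lambda>k. enat k * psd_pt G k) ` {1..graph_order G - 1}"
    unfolding enat_th_star[OF assms] using * by (intro Min_in) auto
  then obtain k where k: "k \<in> {1..graph_order G - 1}" "enat k * psd_pt G k = enat (th_star G)"
    by auto
  have "psd_pt G k \<noteq> \<infinity>"
  proof
    assume "psd_pt G k = \<infinity>"
    with k show False by (simp add: imult_is_infinity enat_0_iff)
  qed
  moreover have "k \<le> graph_order G" using k(1) by auto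
  ultimately obtain t where "psd_pt G k = enat t" "fills_in G k t"
    using psd_pt_attained[of G k] finite_verts by blast
  moreover from this k have "th_star G = k * t" by simp
  moreover from k have "1 \<le> k" "k < graph_order G" by auto
  ultimately show ?thesis using that by blast
qed


section \<open>Forcing sets, chordal completions and brambles\<close>

definition component_of :: "'a pair_pre_digraph \<Rightarrow> 'a set \<Rightarrow> 'a \<Rightarrow> 'a set" where
  "component_of G F w = {u. (w, u) \<in> rtrancl_on (pverts G - F) (parcs G)}"

definition boundary :: "'a pair_pre_digraph \<Rightarrow> 'a set \<Rightarrow> 'a set" where
  "boundary G W = {x \<in> pverts G - W. \<exists>y \<in> W. (x, y) \<in> parcs G}"

text \<open>Forces are carried out one vertex at a time, in any order; inductions then deal with a
  single new vertex, and rounds are recovered in \<open>psd_reaches_funpow\<close>.\<close>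

inductive psd_reaches :: "'a pair_pre_digraph \<Rightarrow> 'a set \<Rightarrow> 'a set \<Rightarrow> bool" for G B where
  start: "psd_reaches G B B"
| force: "psd_reaches G B F \<Longrightarrow> psd_forces G F v w \<Longrightarrow> psd_reaches G B (insert w F)"

definition connected_set :: "'a pair_pre_digraph \<Rightarrow> 'a set \<Rightarrow> bool" where
  "connected_set G X \<longleftrightarrow> (\<forall>x \<in> X. \<forall>y \<in> X. (x, y) \<in> rtrancl_on X (parcs G))"

definition touching :: "'a pair_pre_digraph \<Rightarrow> 'a set \<Rightarrow> 'a set \<Rightarrow> bool" where
  "touching G X Y \<longleftrightarrow> X \<inter> Y \<noteq> {} \<or> (\<exists>x \<in> X. \<exists>y \<in> Y. (x, y) \<in> parcs G)"

lemma component_of_antimono: "F \<subseteq> F' \<Longrightarrow> component_of G F' w \<subseteq> component_of G F w"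
  unfolding component_of_def using rtrancl_on_mono[of "parcs G" "parcs G" "pverts G - F'" "pverts G - F"]
  by auto

lemma component_of_subset: "component_of G F w \<subseteq> pverts G - F"
  unfolding component_of_def by (blast dest: in_rtrancl_on_in_F)

lemma self_in_component_of: "w \<in> pverts G - F \<Longrightarrow> w \<in> component_of G F w"
  by (simp add: component_of_def)

lemma component_of_closed:
  "x \<in> component_of G F w \<Longrightarrow> (x, y) \<in> parcs G \<Longrightarrow> y \<in> pverts G - F \<Longrightarrow> y \<in> component_of G F w"
  unfolding component_of_def by (auto intro: rtrancl_on_into_rtrancl_on)

context pair_graph begin

lemma boundary_component_of: "boundary G (component_of G F w) \<subseteq> F"
proof
  fix x assume "x \<in> boundary G (component_of G F w)"
  then obtain y where y: "x \<in> pverts G" "x \<notin> component_of G F w" "y \<in> component_of G F w" "(y, x) \<in> parcs G"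
    unfolding boundary_def using arcs_symmetric by auto
  then show "x \<in> F" using component_of_closed[of y G F w x] by auto
qed

lemma finite_boundary: "finite (boundary G W)"
  by (rule finite_subset[OF _ finite_verts]) (auto simp: boundary_def)

lemma component_of_eq:
  assumes "u \<in> component_of G F w" shows "component_of G F u = component_of G F w"
proof -
  have "(w, u) \<in> rtrancl_on (pverts G - F) (parcs G)" using assms by (simp add: component_of_def)
  moreover from this have "(u, w) \<in> rtrancl_on (pverts G - F) (parcs G)" by (simp add: rtrancl_on_sym)
  ultimately show ?thesis
    unfolding component_of_def
    by (auto intro: rtrancl_on_trans[of w u] rtrancl_on_trans[of u w])
qed

lemma connected_set_in_component_of:
  assumes "connected_set G X" "X \<subseteq> pverts G" "X \<inter> F = {}" "w \<in> X"
  shows "X \<subseteq> component_of G F w"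
proof
  fix y assume "y \<in> X"
  then have "(w, y) \<in> rtrancl_on X (parcs G)"
    using assms unfolding connected_set_def by blast
  then show "y \<in> component_of G F w"
    unfolding component_of_def
    using rtrancl_on_mono[of "parcs G" "parcs G" X "pverts G - F" w y] assms by auto
qed

lemma psd_forces_iff_component:
  "psd_forces G F v w \<longleftrightarrow> v \<in> F \<and> w \<in> pverts G - F \<and> (v, w) \<in> parcs G \<and>
     (\<forall>u \<in> component_of G F w. (v, u) \<in> parcs G \<longrightarrow> u = w)"
  unfolding psd_forces_iff component_of_def by auto

text \<open>Filling more vertices only shrinks the component of \<open>w\<close>, so
  \<open>w\<close> stays the only neighbour of \<open>v\<close> in it.\<close>

lemma psd_forces_mono:
  assumes "psd_forces G F v w" "F \<subseteq> F'" "w \<notin> F'" shows "psd_forces G F' v w"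
  using assms component_of_antimono[OF assms(2), of G w] unfolding psd_forces_iff_component by blast

lemma psd_reaches_subset:
  assumes "psd_reaches G B F" "B \<subseteq> pverts G" shows "F \<subseteq> pverts G"
  using assms by induction (auto simp: psd_forces_iff)

text \<open>By monotonicity, each force available at \<open>F\<close> remains available after the
  others, unless its target is already filled. So a whole round can be serialised.\<close>

lemma psd_reaches_Un:
  assumes "psd_reaches G B F" "finite A" "\<And>w. w \<in> A \<Longrightarrow> \<exists>v. psd_forces G F v w"
  shows "psd_reaches G B (F \<union> A)"
  using assms(2,3)
proof (induction A rule: finite_induct)
  case (insert w A)
  then have IH: "psd_reaches G B (F \<union> A)" by auto
  obtain v where v: "psd_forces G F v w" using insert.prems by auto
  show ?case
  proof (cases "w \<in> F \<union> A")
    case True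
    then have "F \<union> insert w A = F \<union> A" by auto
    with IH show ?thesis by simp
  next
    case False
    then have "psd_forces G (F \<union> A) v w" using psd_forces_mono[OF v] by auto
    from psd_reaches.force[OF IH this] show ?thesis by simp
  qed
qed (use assms in auto)

lemma psd_reaches_funpow: "psd_reaches G B ((psd_step G ^^ t) B)"
proof (induction t)
  case (Suc t)
  let ?F = "(psd_step G ^^ t) B"
  have "finite {w. \<exists>v. psd_forces G ?F v w}"
    by (rule finite_subset[OF _ finite_verts]) (auto simp: psd_forces_iff)
  then have "psd_reaches G B (?F \<union> {w. \<exists>v. psd_forces G ?F v w})"
    using Suc.IH by (intro psd_reaches_Un) auto
  then show ?case by (simp add: psd_step_def[of G ?F])
qed (simp add: psd_reaches.start)

text \<open>Filling \<open>w\<close> splits its component. Each part can gain only \<open>w\<close>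
  in its boundary and loses \<open>v\<close>, whose sole neighbour in the old component was
  \<open>w\<close>; components not containing \<open>w\<close> gain nothing.\<close>

lemma boundary_after_force:
  assumes "psd_forces G F v w" and x: "x \<in> pverts G - insert w F"
  shows "boundary G (component_of G (insert w F) x) \<subseteq> insert w (boundary G (component_of G F x))"
    and "w \<in> boundary G (component_of G (insert w F) x) \<Longrightarrow> component_of G F x = component_of G F w"
    and "component_of G F x = component_of G F w \<Longrightarrow>
      v \<in> boundary G (component_of G F x) - boundary G (component_of G (insert w F) x)"
proof -
  note f = assms(1)[unfolded psd_forces_iff_component]
  let ?C = "component_of G F x" and ?C' = "component_of G (insert w F) x"
  have sub: "?C' \<subseteq> ?C" by (rule component_of_antimono) auto
  have w': "w \<notin> ?C'" using component_of_subset[of G "insert w F" x] by auto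
  show "boundary G ?C' \<subseteq> insert w (boundary G ?C)"
  proof
    fix y assume y: "y \<in> boundary G ?C'"
    then have "y \<in> insert w F" using boundary_component_of by blast
    moreover have "?C \<inter> F = {}" using component_of_subset[of G F x] by auto
    ultimately show "y \<in> insert w (boundary G ?C)"
      using y sub unfolding boundary_def by blast
  qed
  show "?C = component_of G F w" if "w \<in> boundary G ?C'"
  proof -
    obtain y where y: "y \<in> ?C'" "(w, y) \<in> parcs G" using \<open>w \<in> boundary G ?C'\<close> unfolding boundary_def by auto
    from y(2) have "(y, w) \<in> parcs G" by (rule arcs_symmetric)
    then have "w \<in> ?C" using component_of_closed[of y G F x w] sub y(1) f by auto
    then show ?thesis using component_of_eq by simp
  qed
  show "v \<in> boundary G ?C - boundary G ?C'" if "?C = component_of G F w"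
  proof -
    have "w \<in> ?C" unfolding that using f by (intro self_in_component_of) simp
    moreover have "v \<notin> ?C" using component_of_subset[of G F x] f by auto
    moreover have "v \<in> pverts G" using f in_arcsD1 by auto
    ultimately have "v \<in> boundary G ?C" using f unfolding boundary_def by auto
    moreover have "v \<notin> boundary G ?C'"
    proof
      assume "v \<in> boundary G ?C'"
      then obtain y where "y \<in> ?C'" "(v, y) \<in> parcs G" unfolding boundary_def by auto
      with f sub w' that show False by auto
    qed
    ultimately show ?thesis by blast
  qed
qed

text \<open>Initially boundaries lie in \<open>B\<close>. Afterwards a boundary that gains
  \<open>w\<close> loses \<open>v\<close> in exchange, so its size never grows.\<close>

lemma card_boundary_le:
  assumes "psd_reaches G B F" "B \<subseteq> pverts G" "x \<in> pverts G - F"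
  shows "card (boundary G (component_of G F x)) \<le> card B"
  using assms(1,3)
proof (induction arbitrary: x)
  case start
  show ?case
    using boundary_component_of finite_subset[OF assms(2) finite_verts] by (intro card_mono)
next
  case (force F v w)
  let ?C = "component_of G F x" and ?C' = "component_of G (insert w F) x"
  note b = boundary_after_force[OF force.hyps(2) force.prems]
  have IH: "card (boundary G ?C) \<le> card B" using force by auto
  show ?case
  proof (cases "w \<in> boundary G ?C'")
    case True
    then have v: "v \<in> boundary G ?C" "v \<notin> boundary G ?C'" using b by auto
    then have "boundary G ?C' \<subseteq> insert w (boundary G ?C - {v})" using b(1) by auto
    then have "card (boundary G ?C') \<le> card (insert w (boundary G ?C - {v}))"
      using finite_boundary by (intro card_mono) auto
    also have "\<dots> \<le> Suc (card (boundary G ?C - {v}))" by (rule card_insert_le_m1) auto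
    also have "\<dots> = card (boundary G ?C)"
      using v(1) finite_boundary by (intro card_Suc_Diff1)
    finally show ?thesis using IH by simp
  next
    case False
    then have "boundary G ?C' \<subseteq> boundary G ?C" using b(1) by auto
    then have "card (boundary G ?C') \<le> card (boundary G ?C)"
      using finite_boundary by (intro card_mono)
    then show ?thesis using IH by simp
  qed
qed

text \<open>The bramble sets avoiding the filled set always lie in a single component of the unfilled
  vertices, whose boundary together with the next forced vertex has at most \<open>card B + 1\<close> elements.\<close>

lemma bramble_hitting_set:
  assumes "psd_reaches G B (pverts G)" "B \<subseteq> pverts G"
    and bramble: "\<And>X. X \<in> \<B> \<Longrightarrow> X \<subseteq> pverts G \<and> X \<noteq> {} \<and> connected_set G X"
      "\<And>X Y. X \<in> \<B> \<Longrightarrow> Y \<in> \<B> \<Longrightarrow> touching G X Y"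
  obtains T where "T \<subseteq> pverts G" "card T \<le> card B + 1" "\<And>X. X \<in> \<B> \<Longrightarrow> X \<inter> T \<noteq> {}"
proof (rule ccontr)
  assume contr: "\<not> thesis"
  have no_hit: "\<exists>X \<in> \<B>. X \<inter> T = {}" if "T \<subseteq> pverts G" "card T \<le> card B + 1" for T
    using that contr \<open>\<And>T. \<lbrakk>T \<subseteq> pverts G; card T \<le> card B + 1; \<And>X. X \<in> \<B> \<Longrightarrow> X \<inter> T \<noteq> {}\<rbrakk> \<Longrightarrow> thesis\<close>
    by blast
  \<comment> \<open>Invariant: some bramble set is entirely unfilled. At \<open>F = pverts G\<close>
    this contradicts the nonemptiness of bramble sets.\<close>
  have "\<exists>X \<in> \<B>. X \<inter> F = {}" if "psd_reaches G B F" for F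
    using that
  proof induction
    case start
    show ?case using assms(2) by (intro no_hit) auto
  next
    case (force F v w)
    then obtain X where X: "X \<in> \<B>" "X \<inter> F = {}" by auto
    show ?case
    proof (cases "w \<in> X")
      case False
      then show ?thesis using X by auto
    next
      case True
      let ?C = "component_of G F w"
      have w: "w \<in> pverts G - F" using force.hyps(2) by (simp add: psd_forces_iff)
      have XC: "X \<subseteq> ?C" using bramble(1)[OF X(1)] X(2) True by (intro connected_set_in_component_of) auto
      have "card (insert w (boundary G ?C)) \<le> card (boundary G ?C) + 1"
        by (simp add: card_insert_if finite_boundary)
      also have "\<dots> \<le> card B + 1"
        using card_boundary_le[OF force.hyps(1) assms(2) w] by simp
      finally have "card (insert w (boundary G ?C)) \<le> card B + 1" .
      moreover have "insert w (boundary G ?C) \<subseteq> pverts G" using w by (auto simp: boundary_def)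
      \<comment> \<open>\<open>Y\<close> touches \<open>X\<close>, hence meets \<open>?C\<close> or
        has a neighbour there; avoiding the boundary, it is trapped inside \<open>?C\<close>, and it
        misses \<open>w\<close>. So \<open>Y\<close> replaces \<open>X\<close>.\<close>
      ultimately obtain Y where Y: "Y \<in> \<B>" "Y \<inter> insert w (boundary G ?C) = {}"
        using no_hit by blast
      have stay: "y \<in> ?C" if "x \<in> ?C" "(x, y) \<in> parcs G" "y \<in> Y" for x y
      proof (rule ccontr)
        assume "y \<notin> ?C"
        then have "y \<in> boundary G ?C"
          using that(1) in_arcsD2[OF that(2)] arcs_symmetric[OF that(2)] unfolding boundary_def by auto
        with Y that show False by auto
      qed
      have "touching G X Y" using bramble(2) X Y by blast
      then obtain y where y: "y \<in> Y" "y \<in> ?C"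
        unfolding touching_def using XC stay by blast
      have "z \<in> ?C" if "z \<in> Y" for z
      proof -
        have "(y, z) \<in> rtrancl_on Y (parcs G)"
          using bramble(1)[OF Y(1)] y that unfolding connected_set_def by blast
        then show ?thesis
          by (induction rule: rtrancl_on_induct) (use y stay in auto)
      qed
      then have "Y \<inter> insert w F = {}" using Y component_of_subset[of G F w] by blast
      then show ?thesis using Y by auto
    qed
  qed
  then obtain X where "X \<in> \<B>" "X \<inter> pverts G = {}" using assms(1) by blast
  then show False using bramble(1) by blast
qed

text \<open>The filling order is a reversed elimination order; \<open>H\<close> is the resulting chordal completion,
  of which only the absence of induced 4-cycles coming from \<open>G\<close> is needed.\<close>

lemma chordal_completion:
  assumes "psd_reaches G B F" "B \<subseteq> pverts G"
  obtains H where "sym H" "H \<subseteq> F \<times> F" "parcs G \<inter> F \<times> F \<subseteq> H"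
    "\<And>K. K \<subseteq> F \<Longrightarrow> (\<forall>x \<in> K. \<forall>y \<in> K. x \<noteq> y \<longrightarrow> (x, y) \<in> H) \<Longrightarrow> card K \<le> card B + 1"
    "\<And>x y z w. {x, y, z, w} \<subseteq> F \<Longrightarrow> {(x, z), (z, y), (y, w), (w, x)} \<subseteq> parcs G \<Longrightarrow>
      (x, y) \<in> H \<or> (z, w) \<in> H"
    "\<And>u z w. u \<in> pverts G - F \<Longrightarrow> {z, w} \<subseteq> boundary G (component_of G F u) \<Longrightarrow> (z, w) \<in> H"
  using assms(1)
proof (induction arbitrary: thesis)
  case start
  have "sym (B \<times> B)" by (auto intro: symI)
  moreover have "card K \<le> card B + 1" if "K \<subseteq> B" for K
    using card_mono[OF finite_subset[OF assms(2) finite_verts] that] by simp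
  moreover have "(z, w) \<in> B \<times> B" if "{z, w} \<subseteq> boundary G (component_of G B u)" for u z w
    using that boundary_component_of by blast
  ultimately show ?case by (intro start[of "B \<times> B"]) auto
next
  case (force F v w0)
  from force.IH obtain H where H: "sym H" "H \<subseteq> F \<times> F" "parcs G \<inter> F \<times> F \<subseteq> H"
    and cl: "\<And>K. K \<subseteq> F \<Longrightarrow> (\<forall>x \<in> K. \<forall>y \<in> K. x \<noteq> y \<longrightarrow> (x, y) \<in> H) \<Longrightarrow> card K \<le> card B + 1"
    and c4: "\<And>x y z w. {x, y, z, w} \<subseteq> F \<Longrightarrow> {(x, z), (z, y), (y, w), (w, x)} \<subseteq> parcs G \<Longrightarrow>
      (x, y) \<in> H \<or> (z, w) \<in> H"
    and bd: "\<And>u z w. u \<in> pverts G - F \<Longrightarrow> {z, w} \<subseteq> boundary G (component_of G F u) \<Longrightarrow> (z, w) \<in> H"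
    by blast
  note f = force.hyps(2)[unfolded psd_forces_iff_component]
  have FV: "F \<subseteq> pverts G" using psd_reaches_subset[OF force.hyps(1) assms(2)] .
  have w0: "w0 \<in> pverts G - F" using f by blast
  \<comment> \<open>\<open>N\<close> contains all filled neighbours of \<open>w0\<close> and, by the
    invariant on boundaries, is already a clique of \<open>H\<close>.\<close>
  define N where "N = boundary G (component_of G F w0)"
  have NF: "N \<subseteq> F" unfolding N_def by (rule boundary_component_of)
  have cardN: "card N \<le> card B" unfolding N_def using card_boundary_le[OF force.hyps(1) assms(2) w0] .
  have EN: "z \<in> N" if "z \<in> F" "(w0, z) \<in> parcs G" for z
    unfolding N_def boundary_def
    using that(1) arcs_symmetric[OF that(2)] FV component_of_subset[of G F w0] self_in_component_of[OF w0]
    by auto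
  have NN: "(z, z') \<in> H" if "z \<in> N" "z' \<in> N" for z z'
    using bd[OF w0, of z z'] that unfolding N_def by auto
  have EN': "z \<in> N" if "z \<in> F" "(z, w0) \<in> parcs G" for z
    using EN[OF that(1)] arcs_symmetric[OF that(2)] by simp
  \<comment> \<open>An elimination step in reverse: \<open>w0\<close> is joined to the clique
    \<open>N\<close>. Loops are included because the 4-cycle condition admits coinciding opposite
    corners.\<close>
  define H' where "H' = H \<union> {w0} \<times> insert w0 N \<union> insert w0 N \<times> {w0}"
  show ?case
  proof (rule force.prems)
    show "sym H'" using H(1) unfolding H'_def sym_def by blast
    show "H' \<subseteq> insert w0 F \<times> insert w0 F" using H(2) NF unfolding H'_def by blast
    show "parcs G \<inter> insert w0 F \<times> insert w0 F \<subseteq> H'"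
      using H(3) EN EN' unfolding H'_def by auto
    show "card K \<le> card B + 1"
      if K: "K \<subseteq> insert w0 F" "\<forall>x \<in> K. \<forall>y \<in> K. x \<noteq> y \<longrightarrow> (x, y) \<in> H'" for K
    proof (cases "w0 \<in> K")
      case True
      \<comment> \<open>All other neighbours of \<open>w0\<close> in \<open>H'\<close> lie in
        \<open>N\<close>, which has at most \<open>card B\<close> elements; this is the source of
        \<open>card B + 1\<close>.\<close>
      have "K \<subseteq> insert w0 N"
      proof
        fix y assume y: "y \<in> K"
        have "w0 \<noteq> y \<longrightarrow> (w0, y) \<in> H'" using K(2)[rule_format, OF True y] by simp
        moreover have "(w0, y) \<notin> H" using H(2) w0 by auto
        ultimately show "y \<in> insert w0 N" unfolding H'_def by auto
      qed
      then have "card K \<le> card (insert w0 N)"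
        using finite_boundary by (intro card_mono) (auto simp: N_def)
      also have "\<dots> \<le> card N + 1" using finite_boundary by (simp add: N_def card_insert_if)
      finally show ?thesis using cardN by simp
    next
      case False
      then have "K \<subseteq> F" using K by auto
      moreover have "\<forall>x \<in> K. \<forall>y \<in> K. x \<noteq> y \<longrightarrow> (x, y) \<in> H"
        using K False unfolding H'_def by blast
      ultimately show ?thesis by (rule cl)
    qed
    show "(x, y) \<in> H' \<or> (z, w) \<in> H'"
      if s: "{x, y, z, w} \<subseteq> insert w0 F" and e: "{(x, z), (z, y), (y, w), (w, x)} \<subseteq> parcs G" for x y z w
    proof -
      have ne: "x \<noteq> z" "z \<noteq> y" "y \<noteq> w" "w \<noteq> x" using e no_loops' by auto
      \<comment> \<open>Adjacent corners cannot both be \<open>w0\<close>; two opposite ones can,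
        and then the loop serves. If just one corner is \<open>w0\<close>, its two neighbours on the
        cycle lie in the clique \<open>N\<close>.\<close>
      consider "x = w0" "y = w0" | "z = w0" "w = w0" | "x = w0" "{z, w} \<subseteq> F" | "y = w0" "{z, w} \<subseteq> F"
        | "z = w0" "{x, y} \<subseteq> F" | "w = w0" "{x, y} \<subseteq> F" | "{x, y, z, w} \<subseteq> F"
        using s ne by blast
      then show ?thesis
      proof cases
        case 7
        then show ?thesis using c4[OF 7 e] unfolding H'_def by blast
      next
        case 3
        then have "z \<in> N" "w \<in> N" using e EN EN' by auto
        then show ?thesis using NN unfolding H'_def by auto
      next
        case 4
        then have "z \<in> N" "w \<in> N" using e EN EN' by auto
        then show ?thesis using NN unfolding H'_def by auto
      next
        case 5
        then have "x \<in> N" "y \<in> N" using e EN EN' by auto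
        then show ?thesis using NN unfolding H'_def by auto
      next
        case 6
        then have "x \<in> N" "y \<in> N" using e EN EN' by auto
        then show ?thesis using NN unfolding H'_def by auto
      qed (auto simp: H'_def)
    qed
    show "(z, w) \<in> H'"
      if u: "u \<in> pverts G - insert w0 F" and zw: "{z, w} \<subseteq> boundary G (component_of G (insert w0 F) u)" for u z w
    proof -
      note b = boundary_after_force[OF force.hyps(2) u]
      have sub: "{z, w} \<subseteq> insert w0 (boundary G (component_of G F u))" using zw b(1) by blast
      show ?thesis
      \<comment> \<open>If \<open>w0\<close> lies on the boundary of the new component, that
        component is a part of the one of \<open>w0\<close>, so the other vertex is
        \<open>w0\<close> itself or in \<open>N\<close>.\<close>
      proof (cases "w0 \<in> {z, w}")
        case True
        then have "component_of G F u = component_of G F w0" using b(2) zw by blast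
        then show ?thesis using sub True unfolding H'_def N_def by auto
      next
        case False
        then show ?thesis using bd[of u z w] sub u unfolding H'_def by auto
      qed
    qed
  qed
qed

end

lemma fills_in_psd_reaches:
  assumes "pair_graph G" "fills_in G k t"
  obtains B where "B \<subseteq> pverts G" "card B = k" "psd_reaches G B (pverts G)"
proof -
  obtain B where "B \<subseteq> pverts G" "card B = k" "(psd_step G ^^ t) B = pverts G"
    using assms(2) unfolding fills_in_def by auto
  moreover from this have "psd_reaches G B (pverts G)"
    using pair_graph.psd_reaches_funpow[OF assms(1), of B t] by simp
  ultimately show ?thesis using that by blast
qed

text \<open>The hitting set has at most \<open>l + 1\<close> vertices, and the vertices outside it
  form a clique of the completion, hence number at most \<open>k + 1\<close>; this explains the
  2.\<close>

theorem fills_in_nordhaus_gaddum: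
  assumes G: "pair_graph G" and "fills_in G k t" "fills_in (complement G) l s"
  shows "graph_order G \<le> k + l + 2"
proof -
  interpret pair_graph G by fact
  let ?V = "pverts G"
  obtain B where B: "B \<subseteq> ?V" "card B = k" "psd_reaches G B ?V"
    using fills_in_psd_reaches[OF G assms(2)] .
  obtain C where C: "C \<subseteq> ?V" "card C = l" "psd_reaches (complement G) C ?V"
    using fills_in_psd_reaches[OF pair_graph_complement[OF G] assms(3)] by auto
  obtain H where H: "sym H" "parcs G \<inter> ?V \<times> ?V \<subseteq> H"
    and cl: "\<And>K. K \<subseteq> ?V \<Longrightarrow> (\<forall>x \<in> K. \<forall>y \<in> K. x \<noteq> y \<longrightarrow> (x, y) \<in> H) \<Longrightarrow> card K \<le> k + 1"
    and c4: "\<And>x y z w. {x, y, z, w} \<subseteq> ?V \<Longrightarrow> {(x, z), (z, y), (y, w), (w, x)} \<subseteq> parcs G \<Longrightarrow>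
      (x, y) \<in> H \<or> (z, w) \<in> H"
    using chordal_completion[OF B(3,1)] B(2) by metis
  define \<B> where "\<B> = {{x, y} | x y. x \<in> ?V \<and> y \<in> ?V \<and> x \<noteq> y \<and> (x, y) \<notin> H}"
  interpret c: pair_graph "complement G" using pair_graph_complement[OF G] .
  have conn: "X \<subseteq> pverts (complement G) \<and> X \<noteq> {} \<and> connected_set (complement G) X" if "X \<in> \<B>" for X
  proof -
    obtain x y where X: "X = {x, y}" "x \<in> ?V" "y \<in> ?V" "x \<noteq> y" "(x, y) \<notin> H"
      using \<open>X \<in> \<B>\<close> unfolding \<B>_def by blast
    then have "(x, y) \<in> parcs (complement G)" "(y, x) \<in> parcs (complement G)"
      using H arcs_symmetric by auto
    then have "(x, y) \<in> rtrancl_on X (parcs (complement G))" "(y, x) \<in> rtrancl_on X (parcs (complement G))"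
      unfolding X(1) by (auto intro: rtrancl_on_into_rtrancl_on)
    then show ?thesis using X unfolding connected_set_def by auto
  qed
  have touch: "touching (complement G) X Y" if "X \<in> \<B>" "Y \<in> \<B>" for X Y
  proof (rule ccontr)
    assume n: "\<not> touching (complement G) X Y"
    obtain x y where X: "X = {x, y}" "x \<in> ?V" "y \<in> ?V" "x \<noteq> y" "(x, y) \<notin> H"
      using \<open>X \<in> \<B>\<close> unfolding \<B>_def by blast
    obtain z w where Y: "Y = {z, w}" "z \<in> ?V" "w \<in> ?V" "z \<noteq> w" "(z, w) \<notin> H"
      using \<open>Y \<in> \<B>\<close> unfolding \<B>_def by blast
    \<comment> \<open>Two pairs that do not touch in the complement are completely joined in
      \<open>G\<close>, and the 4-cycle \<open>x z y w\<close> then has neither diagonal in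
      \<open>H\<close>.\<close>
    have "{(x, z), (z, y), (y, w), (w, x)} \<subseteq> parcs G"
      using n X Y arcs_symmetric unfolding touching_def by auto
    then show False using c4[of x y z w] X Y by auto
  qed
  have "psd_reaches (complement G) C (pverts (complement G))" "C \<subseteq> pverts (complement G)"
    using C by auto
  from c.bramble_hitting_set[OF this conn touch]
  obtain T where T: "T \<subseteq> ?V" "card T \<le> l + 1" "\<And>X. X \<in> \<B> \<Longrightarrow> X \<inter> T \<noteq> {}"
    using C(2) by auto
  have "(x, y) \<in> H" if "x \<in> ?V - T" "y \<in> ?V - T" "x \<noteq> y" for x y
  proof (rule ccontr)
    assume "(x, y) \<notin> H"
    then have "{x, y} \<in> \<B>" using that unfolding \<B>_def by blast
    then show False using T(3) that by blast
  qed
  then have "card (?V - T) \<le> k + 1" by (intro cl) auto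
  moreover have "card (?V - T) = graph_order G - card T"
    using T(1) finite_subset[OF T(1) finite_verts] by (simp add: graph_order_def card_Diff_subset)
  ultimately show ?thesis using T(2) by linarith
qed


section \<open>Degrees and one-step forcing\<close>

context pair_graph begin

text \<open>\<open>W\<close> may be larger than the component of \<open>w\<close>: any set closed
  under unfilled neighbours contains that component.\<close>

lemma psd_forcesI:
  assumes "v \<in> B" "(v, w) \<in> parcs G" "w \<in> W" "W \<subseteq> pverts G - B"
    and closed: "\<And>x y. x \<in> W \<Longrightarrow> (x, y) \<in> parcs G \<Longrightarrow> y \<notin> B \<Longrightarrow> y \<in> W"
    and unique: "\<And>u. u \<in> W \<Longrightarrow> (v, u) \<in> parcs G \<Longrightarrow> u = w"
  shows "psd_forces G B v w"
proof -
  have "u \<in> W" if "(w, u) \<in> rtrancl_on (pverts G - B) (parcs G)" for u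
    using that by (induction rule: rtrancl_on_induct) (use assms(3) closed in auto)
  then show ?thesis using assms unfolding psd_forces_iff by blast
qed

lemma fills_in_order: "fills_in G (graph_order G) 0"
  by (auto simp: fills_in_def graph_order_def)

lemma fills_in_0:
  assumes "fills_in G k 0" shows "k = graph_order G"
  using assms by (auto simp: fills_in_def graph_order_def)

lemma fills_in_1I:
  assumes "B \<subseteq> pverts G" "\<And>w. w \<in> pverts G - B \<Longrightarrow> \<exists>v. psd_forces G B v w"
  shows "fills_in G (card B) 1"
proof -
  have "psd_step G B = pverts G"
    using assms by (auto simp: psd_step_def psd_forces_iff)
  then have "(psd_step G ^^ 1) B = pverts G" by simp
  then show ?thesis using assms(1) unfolding fills_in_def by blast
qed

lemma fills_in_1D:
  assumes "fills_in G k 1"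
  obtains B where "B \<subseteq> pverts G" "card B = k" "\<And>w. w \<in> pverts G - B \<Longrightarrow> \<exists>v. psd_forces G B v w"
proof -
  obtain B where B: "B \<subseteq> pverts G" "card B = k" "psd_step G B = pverts G"
    using assms by (auto simp: fills_in_def)
  then have "\<exists>v. psd_forces G B v w" if "w \<in> pverts G - B" for w
    using that unfolding psd_step_def by auto
  with B that show ?thesis by blast
qed

text \<open>Let \<open>C\<close> be the component of an unfilled \<open>w\<close>. Each other
  \<open>u\<close> in \<open>C\<close> has its own forcer in \<open>B\<close>, not adjacent to
  \<open>w\<close>. So \<open>w\<close> has at most \<open>card C - 1\<close> neighbours in
  \<open>C\<close> and at most \<open>k - (card C - 1)\<close> in \<open>B\<close>.\<close>

lemma fills_in_1_degree:
  assumes "fills_in G k 1"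
  obtains B where "B \<subseteq> pverts G" "card B = k"
    "\<And>w. w \<in> pverts G - B \<Longrightarrow> card {y. (w, y) \<in> parcs G} \<le> k"
proof -
  obtain B where B: "B \<subseteq> pverts G" "card B = k"
    and forced: "\<And>w. w \<in> pverts G - B \<Longrightarrow> \<exists>v. psd_forces G B v w"
    using fills_in_1D[OF assms] by blast
  then obtain g where g: "psd_forces G B (g w) w" if "w \<in> pverts G - B" for w
    by metis
  have "card {y. (w, y) \<in> parcs G} \<le> k" if w: "w \<in> pverts G - B" for w
  proof -
    define C where "C = component_of G B w"
    have CV: "C \<subseteq> pverts G - B" unfolding C_def by (rule component_of_subset)
    have wC: "w \<in> C" unfolding C_def using w by (rule self_in_component_of)
    have Ceq: "component_of G B u = C" if "u \<in> C" for u
      using that unfolding C_def by (rule component_of_eq)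
    have gC: "g u \<in> B \<and> (g u, u) \<in> parcs G \<and> (\<forall>x \<in> C. (g u, x) \<in> parcs G \<longrightarrow> x = u)" if "u \<in> C" for u
      using g[of u] that CV Ceq[OF that] unfolding psd_forces_iff_component by auto
    have inj: "inj_on g (C - {w})"
      by (rule inj_onI) (metis DiffD1 gC)
    have finC: "finite C" using CV finite_verts by (meson finite_Diff finite_subset)
    have finB: "finite B" using B(1) finite_verts by (rule finite_subset)
    have sub: "{y. (w, y) \<in> parcs G} \<subseteq> (C - {w}) \<union> (B - g ` (C - {w}))"
    proof
      fix y assume "y \<in> {y. (w, y) \<in> parcs G}"
      then have y: "(w, y) \<in> parcs G" by simp
      have "y \<in> C" if "y \<notin> B"
        using component_of_closed[of w G B w y] wC y that in_arcsD2[OF y] unfolding C_def by auto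
      moreover have "y \<noteq> w" using no_loops'[OF y] by simp
      moreover have "y \<notin> g ` (C - {w})"
      proof
        assume "y \<in> g ` (C - {w})"
        then obtain u where "u \<in> C" "u \<noteq> w" "y = g u" by auto
        then show False using gC[of u] wC arcs_symmetric[OF y] by auto
      qed
      ultimately show "y \<in> (C - {w}) \<union> (B - g ` (C - {w}))" by auto
    qed
    have gB: "g ` (C - {w}) \<subseteq> B" using gC by auto
    have "card {y. (w, y) \<in> parcs G} \<le> card ((C - {w}) \<union> (B - g ` (C - {w})))"
      using sub finC finB by (intro card_mono) auto
    also have "\<dots> \<le> card (C - {w}) + card (B - g ` (C - {w}))" by (rule card_Un_le)
    also have "card (B - g ` (C - {w})) = card B - card (C - {w})"
      using gB finC inj by (simp add: card_Diff_subset card_image)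
    also have "card (C - {w}) + (card B - card (C - {w})) = card B"
      using card_mono[OF finB gB] inj by (simp add: card_image)
    finally show ?thesis using B by simp
  qed
  with B that show ?thesis by blast
qed

lemma degree_complement:
  assumes "w \<in> pverts G"
  shows "card {y. (w, y) \<in> parcs G} + card {y. (w, y) \<in> parcs (complement G)} = graph_order G - 1"
proof -
  have "{y. (w, y) \<in> parcs G} \<union> {y. (w, y) \<in> parcs (complement G)} = pverts G - {w}"
    using assms in_arcsD2 no_loops' by auto
  moreover have "card ({y. (w, y) \<in> parcs G} \<union> {y. (w, y) \<in> parcs (complement G)}) =
    card {y. (w, y) \<in> parcs G} + card {y. (w, y) \<in> parcs (complement G)}"
  proof (intro card_Un_disjoint)
    show "finite {y. (w, y) \<in> parcs G}" "finite {y. (w, y) \<in> parcs (complement G)}"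
      by (rule finite_subset[OF _ finite_verts], use in_arcsD2 in auto)+
  qed auto
  ultimately show ?thesis using assms by (simp add: graph_order_def)
qed

text \<open>\<open>D\<close> consists of the unfilled vertices: degree at most \<open>k\<close> in
  the complement means degree at least \<open>graph_order G - 1 - k\<close> in
  \<open>G\<close>.\<close>

lemma fills_in_complement_1_degree:
  assumes "fills_in (complement G) k 1"
  obtains D where "D \<subseteq> pverts G" "card D = graph_order G - k"
    "\<And>w. w \<in> D \<Longrightarrow> card D - 1 \<le> card {y. (w, y) \<in> parcs G}"
proof -
  interpret c: pair_graph "complement G" by (rule pair_graph_complement) unfold_locales
  obtain B where B: "B \<subseteq> pverts G" "card B = k"
    "\<And>w. w \<in> pverts G - B \<Longrightarrow> card {y. (w, y) \<in> parcs (complement G)} \<le> k"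
    using c.fills_in_1_degree[OF assms] by (metis pverts_complement)
  have card: "card (pverts G - B) = graph_order G - k"
    using B finite_verts by (simp add: graph_order_def card_Diff_subset finite_subset)
  moreover have "card (pverts G - B) - 1 \<le> card {y. (w, y) \<in> parcs G}" if "w \<in> pverts G - B" for w
    using degree_complement[of w] B(3)[OF that] that unfolding card by simp
  ultimately show ?thesis by (intro that[of "pverts G - B"]) auto
qed

text \<open>The complement supplies four vertices of degree at least 3 in \<open>G\<close>, whereas
  \<open>G\<close> allows such degrees only in the two-element \<open>B\<close>. This is the case of
  equality in \<open>graph_order G \<le> k + l + 2\<close> with \<open>k = 2\<close> and one round
  on both sides.\<close>

lemma not_fills_in_2_1_both:
  assumes "fills_in G 2 1" "fills_in (complement G) (graph_order G - 4) 1" "graph_order G \<ge> 4"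
  shows False
proof -
  obtain B where B: "B \<subseteq> pverts G" "card B = 2"
    "\<And>w. w \<in> pverts G - B \<Longrightarrow> card {y. (w, y) \<in> parcs G} \<le> 2"
    using fills_in_1_degree[OF assms(1)] by blast
  obtain D where D: "D \<subseteq> pverts G" "card D = graph_order G - (graph_order G - 4)"
    "\<And>w. w \<in> D \<Longrightarrow> card D - 1 \<le> card {y. (w, y) \<in> parcs G}"
    using fills_in_complement_1_degree[OF assms(2)] by blast
  have card: "card D = 4" using D(2) assms(3) by simp
  have "D \<subseteq> B"
  proof
    fix w assume "w \<in> D"
    then show "w \<in> B" using B(3)[of w] D(3)[of w] D(1) card by (cases "w \<in> B") auto
  qed
  then have "card D \<le> card B" using B(1) finite_verts by (meson card_mono finite_subset)
  then show False using card B(2) by simp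
qed

end

section \<open>Consequences of both graphs being connected\<close>

lemma co_connected_neighbour:
  assumes "co_connected G" "v \<in> pverts G" "graph_order G \<ge> 2"
  obtains u where "(v, u) \<in> parcs G"
proof -
  have "{v} \<noteq> pverts G"
  proof
    assume "{v} = pverts G"
    then have "graph_order G = 1" unfolding graph_order_def by (metis card_1_singleton_iff One_nat_def)
    then show False using assms(3) by simp
  qed
  then show ?thesis using co_connected_cut[OF assms(1), of "{v}"] assms(2) that by auto
qed

text \<open>A single filled vertex would have to be adjacent to all others, but it has a neighbour
  in the complement.\<close>

lemma not_fills_in_1_1:
  assumes "co_connected G" "graph_order G \<ge> 2" shows "\<not> fills_in G 1 1"
proof
  interpret pair_graph G using assms(1) by (simp add: co_connected_def)
  assume "fills_in G 1 1"
  then obtain B where B: "B \<subseteq> pverts G" "card B = 1" "\<And>w. w \<in> pverts G - B \<Longrightarrow> \<exists>v. psd_forces G B v w"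
    using fills_in_1D by blast
  then obtain c where c: "B = {c}" by (auto simp: card_1_singleton_iff)
  obtain u where "(c, u) \<in> parcs (complement G)"
    using co_connected_neighbour[OF co_connected_complement[OF assms(1)]] assms(2) B(1) c by auto
  moreover from this obtain v where "psd_forces G {c} v u" using B c by auto
  ultimately show False by (auto simp: psd_forces_iff)
qed

text \<open>All but two nonadjacent vertices are filled; each of the two is then a component by
  itself and is forced by any of its neighbours.\<close>

lemma fills_in_order_minus_2:
  assumes "co_connected G" "graph_order G \<ge> 2"
  shows "fills_in G (graph_order G - 2) 1"
proof -
  interpret pair_graph G using assms(1) by (simp add: co_connected_def)
  have "pverts G \<noteq> {}" using assms(2) by (auto simp: graph_order_def)
  then obtain p where p: "p \<in> pverts G" by blast
  obtain q where q: "(p, q) \<in> parcs (complement G)"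
    using co_connected_neighbour[OF co_connected_complement[OF assms(1)]] assms(2) p by auto
  let ?B = "pverts G - {p, q}"
  have "\<exists>v. psd_forces G ?B v w" if "w \<in> pverts G - ?B" for w
  proof -
    have w: "w \<in> {p, q}" "w \<in> pverts G" using that by auto
    obtain v where v: "(w, v) \<in> parcs G" using co_connected_neighbour[OF assms(1) w(2) assms(2)] .
    have "(x, y) \<notin> parcs G" if "x \<in> {p, q}" "y \<in> {p, q}" for x y
      using that q no_loops' arcs_symmetric by auto
    then have "psd_forces G ?B v w"
      using w v arcs_symmetric[OF v] in_arcsD2[OF v] by (intro psd_forcesI[where W = "{w}"]) (auto dest: in_arcsD2)
    then show ?thesis ..
  qed
  then have "fills_in G (card ?B) 1" by (intro fills_in_1I) auto
  moreover have "card ?B = graph_order G - 2"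
    using p q by (simp add: graph_order_def card_Diff_subset)
  ultimately show ?thesis by simp
qed

lemma co_connected_parcs:
  assumes "co_connected G" "graph_order G \<ge> 2"
  shows "pair_graph G" "parcs G \<noteq> {}" "finite (pverts G)" "pverts G \<noteq> {}"
proof -
  show *: "pair_graph G" using assms(1) by (simp add: co_connected_def)
  interpret pair_graph G by fact
  show "finite (pverts G)" by (rule finite_verts)
  show V: "pverts G \<noteq> {}" using assms(2) by (auto simp: graph_order_def)
  then obtain v where "v \<in> pverts G" by blast
  then show "parcs G \<noteq> {}" using co_connected_neighbour[OF assms(1) _ assms(2)] by blast
qed

lemma fills_in_cases:
  assumes "co_connected G" "graph_order G \<ge> 2" "fills_in G k t" "k \<ge> 1"
  shows "k = graph_order G \<or> t \<ge> 1 \<and> k < graph_order G \<and> (k = 1 \<longrightarrow> t \<ge> 2)"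
proof -
  have "k = graph_order G" if "t = 0"
    using that assms(3) pair_graph.fills_in_0[OF co_connected_parcs(1)[OF assms(1,2)]] by simp
  moreover have "k \<noteq> 1 \<or> t \<noteq> 1" using not_fills_in_1_1[OF assms(1,2)] assms(3) by auto
  ultimately show ?thesis
    using fills_in_le[OF co_connected_parcs(3)[OF assms(1,2)] assms(3)] assms(4) by linarith
qed

context
  fixes G :: "'a pair_pre_digraph" and n :: nat
  assumes co: "co_connected G" and n: "graph_order G = n" and n4: "n \<ge> 4"
begin

text \<open>These four facts carry the lower bounds on the throttling numbers; what remains is
  arithmetic with the two pairs.\<close>

lemma fills_in_both:
  assumes "fills_in G k t" "k \<ge> 1" "fills_in (complement G) l s" "l \<ge> 1"
  shows "n \<le> k + l + 2" "k = n \<or> t \<ge> 1 \<and> k < n \<and> (k = 1 \<longrightarrow> t \<ge> 2)"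
    "l = n \<or> s \<ge> 1 \<and> l < n \<and> (l = 1 \<longrightarrow> s \<ge> 2)"
    "\<not> (k = 2 \<and> t = 1 \<and> l + 4 = n \<and> s = 1)"
proof -
  have n2: "graph_order G \<ge> 2" using n n4 by simp
  show "n \<le> k + l + 2"
    using fills_in_nordhaus_gaddum[OF co_connected_parcs(1)[OF co n2] assms(1,3)] n by simp
  show "k = n \<or> t \<ge> 1 \<and> k < n \<and> (k = 1 \<longrightarrow> t \<ge> 2)"
    using fills_in_cases[OF co n2 assms(1,2)] n by simp
  show "l = n \<or> s \<ge> 1 \<and> l < n \<and> (l = 1 \<longrightarrow> s \<ge> 2)"
    using fills_in_cases[OF co_connected_complement[OF co] _ assms(3,4)] n2 n by simp
  show "\<not> (k = 2 \<and> t = 1 \<and> l + 4 = n \<and> s = 1)"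
  proof
    assume "k = 2 \<and> t = 1 \<and> l + 4 = n \<and> s = 1"
    then have "l = graph_order G - 4" "k = 2" "t = 1" "s = 1" using n by auto
    then show False
      using pair_graph.not_fills_in_2_1_both[OF co_connected_parcs(1)[OF co n2]] assms n n4 by metis
  qed
qed

lemma th_plus_bounds:
  shows "3 \<le> th_plus G" "th_plus G \<le> n - 1"
    "n \<le> th_plus G + th_plus (complement G)"
    "th_plus G = 3 \<Longrightarrow> n \<le> th_plus (complement G) + 2"
proof -
  have n2: "graph_order G \<ge> 2" "graph_order (complement G) \<ge> 2" using n n4 by auto
  note c = co_connected_complement[OF co]
  have "th_plus G \<le> (n - 2) + 1"
    using th_plus_le[OF co_connected_parcs(3,4)[OF co n2(1)] fills_in_order_minus_2[OF co n2(1)]] n n4 by simp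
  then show "th_plus G \<le> n - 1" using n4 by linarith
  obtain k t where k: "1 \<le> k" "k \<le> n" "fills_in G k t" "th_plus G = k + t"
    using th_plus_attained[OF co_connected_parcs(3,4)[OF co n2(1)]] n by auto
  obtain l s where l: "1 \<le> l" "l \<le> n" "fills_in (complement G) l s" "th_plus (complement G) = l + s"
    using th_plus_attained[OF co_connected_parcs(3,4)[OF c n2(2)]] n by auto
  note f = fills_in_both[OF k(3,1) l(3,1)]
  show "3 \<le> th_plus G" using f(2) k n4 by linarith
  show "n \<le> th_plus G + th_plus (complement G)" using f(1-3) k(4) l(4) by linarith
  \<comment> \<open>The value 3 comes from (1, 2), whence \<open>l \<ge> n - 3\<close>, or from (2,
    1), where \<open>l = n - 4\<close> requires \<open>s \<ge> 2\<close>.\<close>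
  show "n \<le> th_plus (complement G) + 2" if "th_plus G = 3"
    using f k(4) l(4) that n4 by linarith
qed

lemma th_star_bounds:
  shows "2 \<le> th_star G" "th_star G \<le> n - 2"
    "n \<le> th_star G + th_star (complement G) + 2"
    "n = 6 \<Longrightarrow> th_star G = 2 \<Longrightarrow> th_star (complement G) \<noteq> 2"
proof -
  have n2: "graph_order G \<ge> 2" "graph_order (complement G) \<ge> 2" using n n4 by auto
  note c = co_connected_complement[OF co]
  have "fills_in G (n - 2) 1" using fills_in_order_minus_2[OF co n2(1)] n by simp
  then show "th_star G \<le> n - 2"
    using th_star_le[OF co_connected_parcs(1,2)[OF co n2(1)], of "n - 2" 1] n n4 by simp
  obtain k t where k: "1 \<le> k" "k < n" "fills_in G k t" "th_star G = k * t"
    using th_star_attained[OF co_connected_parcs(1,2)[OF co n2(1)]] n by auto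
  obtain l s where l: "1 \<le> l" "l < n" "fills_in (complement G) l s" "th_star (complement G) = l * s"
    using th_star_attained[OF co_connected_parcs(1,2)[OF c n2(2)]] n by auto
  note f = fills_in_both[OF k(3,1) l(3,1)]
  have ge: "k \<le> th_star G" "l \<le> th_star (complement G)" using f k l by auto
  show "2 \<le> th_star G"
  proof (cases "k = 1")
    case False
    then show ?thesis using ge k(1) by linarith
  qed (use f k in auto)
  show "n \<le> th_star G + th_star (complement G) + 2" using f(1) ge by linarith
  \<comment> \<open>Here \<open>k = l = 2\<close> with one round each, which is the excluded
    configuration at \<open>n = 6\<close>.\<close>
  show "th_star (complement G) \<noteq> 2" if "n = 6" "th_star G = 2"
  proof
    assume "th_star (complement G) = 2"
    then have "k = 2" "l = 2" using f(1) ge that by auto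
    then show False using f(4) k l that \<open>th_star (complement G) = 2\<close> by auto
  qed
qed

lemma th_times_bounds:
  shows "3 \<le> th_times G" "th_times G \<le> n"
    "th_times G = n \<or> th_times (complement G) = n \<or> 2 * n \<le> th_times G + th_times (complement G) + 4"
    "th_times G = 3 \<Longrightarrow> th_times (complement G) = n \<or> 2 * n \<le> th_times (complement G) + 6"
    "n = 6 \<Longrightarrow> th_times G = 4 \<Longrightarrow> th_times (complement G) \<noteq> 4"
proof -
  have n2: "graph_order G \<ge> 2" "graph_order (complement G) \<ge> 2" using n n4 by auto
  note c = co_connected_complement[OF co]
  have "fills_in G n 0" "fills_in (complement G) n 0"
    using pair_graph.fills_in_order[OF co_connected_parcs(1)[OF co n2(1)]]
      pair_graph.fills_in_order[OF co_connected_parcs(1)[OF c n2(2)]] n by auto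
  then show le: "th_times G \<le> n"
    using th_times_le[OF co_connected_parcs(3,4)[OF co n2(1)], of n 0] n n4 by simp
  obtain k t where k: "1 \<le> k" "k \<le> n" "fills_in G k t" "th_times G = k * (1 + t)"
    using th_times_attained[OF co_connected_parcs(3,4)[OF co n2(1)]] n by auto
  obtain l s where l: "1 \<le> l" "l \<le> n" "fills_in (complement G) l s" "th_times (complement G) = l * (1 + s)"
    using th_times_attained[OF co_connected_parcs(3,4)[OF c n2(2)]] n by auto
  note f = fills_in_both[OF k(3,1) l(3,1)]
  have tn: "th_times G = n" if "k = n"
  proof -
    have "n \<le> k * (1 + t)" using that by simp
    with le k(4) show ?thesis by linarith
  qed
  have "th_times (complement G) \<le> n"
    using th_times_le[OF co_connected_parcs(3,4)[OF c n2(2)], of n 0] \<open>fills_in (complement G) n 0\<close> n n4 by simp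
  moreover have "n \<le> l * (1 + s)" if "l = n" using that by simp
  ultimately have sn: "th_times (complement G) = n" if "l = n" using that l(4) by linarith
  \<comment> \<open>Unless everything is filled at the start, at least one round is needed, so the
    factor \<open>1 + t\<close> is at least 2.\<close>
  have ge: "k * 2 \<le> th_times G" if "k \<noteq> n"
    unfolding k(4) using that f(2) by (intro mult_le_mono2) linarith
  have ge': "l * 2 \<le> th_times (complement G)" if "l \<noteq> n"
    unfolding l(4) using that f(3) by (intro mult_le_mono2) linarith
  show three: "3 \<le> th_times G"
  proof (cases "k = n")
    case False
    then show ?thesis
    proof (cases "k = 1")
      case True
      then show ?thesis using f(2) k(4) False by simp
    next
      case k1: False
      then show ?thesis using ge[OF False] k(1) by linarith
    qed
  qed (use tn n4 in simp)
  show "th_times G = n \<or> th_times (complement G) = n \<or> 2 * n \<le> th_times G + th_times (complement G) + 4"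
    using tn sn ge ge' f(1) by linarith
  show "th_times (complement G) = n \<or> 2 * n \<le> th_times (complement G) + 6" if "th_times G = 3"
  proof -
    have "k \<noteq> n" using tn that n4 by auto
    then have "k = 1" using ge that k(1) by linarith
    then show ?thesis using sn ge' f(1) by linarith
  qed
  show "th_times (complement G) \<noteq> 4" if n6: "n = 6" and G4: "th_times G = 4"
  proof
    assume c4: "th_times (complement G) = 4"
    have "k \<noteq> n" "l \<noteq> n" using tn sn G4 c4 n6 by auto
    then have kl: "k = 2" "l = 2" using ge ge' f(1) G4 c4 n6 by auto
    then show False using f(4) k(4) l(4) G4 c4 n6 by auto
  qed
qed

end


section \<open>Induced paths and graphs of order four and five\<close>

text \<open>Connectedness phrased through cuts of a bare relation: it applies alike to adjacency and
  to its negation, whose diagonal is harmless since cuts compare distinct vertices.\<close>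

definition cut_connected :: "'a set \<Rightarrow> ('a \<Rightarrow> 'a \<Rightarrow> bool) \<Rightarrow> bool" where
  "cut_connected V R \<longleftrightarrow> (\<forall>A \<subseteq> V. A \<noteq> {} \<longrightarrow> A \<noteq> V \<longrightarrow> (\<exists>x \<in> A. \<exists>y \<in> V - A. R x y))"

text \<open>The pattern together with symmetry of \<open>R\<close> forces the four vertices to be
  distinct.\<close>

definition has_induced_P4 :: "'a set \<Rightarrow> ('a \<Rightarrow> 'a \<Rightarrow> bool) \<Rightarrow> bool" where
  "has_induced_P4 V R \<longleftrightarrow> (\<exists>a \<in> V. \<exists>b \<in> V. \<exists>c \<in> V. \<exists>d \<in> V.
     R a b \<and> R b c \<and> R c d \<and> \<not> R a c \<and> \<not> R b d \<and> \<not> R a d)"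

lemma cut_connectedD:
  assumes "cut_connected V R" "A \<subseteq> V" "A \<noteq> {}" "A \<noteq> V"
  obtains x y where "x \<in> A" "y \<in> V - A" "R x y"
  using assms unfolding cut_connected_def by meson

text \<open>The path on four vertices is self-complementary: \<open>a b c d\<close> in one graph is
  \<open>b d a c\<close> in the other.\<close>

lemma has_induced_P4_complement:
  assumes "symp R" "has_induced_P4 V (\<lambda>x y. \<not> R x y)"
  shows "has_induced_P4 V R"
proof -
  obtain a b c d where "a \<in> V" "b \<in> V" "c \<in> V" "d \<in> V"
    "\<not> R a b" "\<not> R b c" "\<not> R c d" "R a c" "R b d" "R a d"
    using assms(2) unfolding has_induced_P4_def by auto
  then show ?thesis
    unfolding has_induced_P4_def
    using sympD[OF assms(1)]
    by (intro bexI[of _ b] bexI[of _ d] bexI[of _ a] bexI[of _ c]) auto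
qed

text \<open>In the side \<open>A\<close> containing the non-neighbour \<open>w\<close> of
  \<open>v\<close>, connectedness yields an edge \<open>x y\<close> from a non-neighbour to a
  neighbour of \<open>v\<close>; a neighbour \<open>z\<close> of \<open>v\<close> on the other side
  completes the path \<open>x y v z\<close>.\<close>

lemma has_induced_P4_if_cut_vertex:
  assumes "symp R" "cut_connected V R" "v \<in> V" "w \<in> V - {v}" "\<not> R v w" "\<not> cut_connected (V - {v}) R"
  shows "has_induced_P4 V R"
proof -
  note sym = sympD[OF assms(1)]
  obtain A0 where A0: "A0 \<subseteq> V - {v}" "A0 \<noteq> {}" "A0 \<noteq> V - {v}"
    "\<And>x y. x \<in> A0 \<Longrightarrow> y \<in> V - {v} - A0 \<Longrightarrow> \<not> R x y"
    using assms(6) unfolding cut_connected_def by auto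
  define A where "A = (if w \<in> A0 then A0 else V - {v} - A0)"
  have wA: "w \<in> A" using assms(4) unfolding A_def by auto
  have A: "A \<subseteq> V - {v}" "A \<noteq> V - {v}" using A0(1-3) unfolding A_def by auto
  have no_edge: "\<not> R x y" if "x \<in> A" "y \<in> V - {v} - A" for x y
  proof (cases "w \<in> A0")
    case True
    then show ?thesis using A0(4) that unfolding A_def by simp
  next
    case False
    then have "y \<in> A0" "x \<in> V - {v} - A0" using that unfolding A_def by auto
    then show ?thesis using A0(4) sym by blast
  qed
  define N where "N = {x \<in> A. \<not> R v x}"
  have "N \<subseteq> V" "N \<noteq> {}" "N \<noteq> V" using A wA assms(3,5) unfolding N_def by auto
  then obtain x y where xy: "x \<in> N" "y \<in> V - N" "R x y"
    using cut_connectedD[OF assms(2)] by metis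
  have "y \<noteq> v" using xy sym unfolding N_def by auto
  then have y: "y \<in> A" "R v y" using no_edge[of x y] xy unfolding N_def by auto
  define A' where "A' = V - {v} - A"
  have "A' \<subseteq> V" "A' \<noteq> {}" "A' \<noteq> V" using A assms(3) unfolding A'_def by auto
  then obtain z u where zu: "z \<in> A'" "u \<in> V - A'" "R z u"
    using cut_connectedD[OF assms(2)] by metis
  have "u = v"
  proof (rule ccontr)
    assume "u \<noteq> v"
    then have "u \<in> A" using zu unfolding A'_def by auto
    then show False using no_edge[of u z] zu sym unfolding A'_def by auto
  qed
  then have z: "R v z" "z \<in> V" using zu sym unfolding A'_def by auto
  have "\<not> R x z" "\<not> R y z" using no_edge[of _ z] xy y zu unfolding A'_def N_def by auto
  moreover have "\<not> R x v" using xy sym unfolding N_def by auto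
  moreover have "x \<in> V" "y \<in> V" using xy A unfolding N_def by auto
  ultimately show ?thesis
    unfolding has_induced_P4_def using xy y z sym assms(3)
    by (intro bexI[of _ x] bexI[of _ y] bexI[of _ v] bexI[of _ z]) auto
qed

lemma has_induced_P4_mono: "has_induced_P4 V R \<Longrightarrow> V \<subseteq> W \<Longrightarrow> has_induced_P4 W R"
  unfolding has_induced_P4_def by blast

text \<open>The connectivity property of cographs, in contrapositive form. Induction removes a
  vertex \<open>v\<close>: either \<open>v\<close> is a cut vertex of one of the two graphs, or both
  stay connected.\<close>

lemma induced_P4_exists:
  assumes "finite V" "card V \<ge> 2" "symp R" "cut_connected V R" "cut_connected V (\<lambda>x y. \<not> R x y)"
  shows "has_induced_P4 V R"
  using assms(1,2,4,5)
proof (induction "card V" arbitrary: V)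
  case (Suc n)
  let ?N = "\<lambda>x y. \<not> R x y"
  have symN: "symp ?N" using assms(3) by (auto simp: symp_def)
  have NN: "(\<lambda>x y. \<not> ?N x y) = R" by auto
  obtain v where v: "v \<in> V" using Suc.prems(2) by fastforce
  have "{v} \<noteq> V" using Suc.prems(2) by auto
  then obtain w w' where w: "w \<in> V - {v}" "\<not> R v w" and w': "w' \<in> V - {v}" "R v w'"
    using cut_connectedD[OF Suc.prems(3), of "{v}"] cut_connectedD[OF Suc.prems(4), of "{v}"] v
    by (metis empty_subsetI insert_not_empty insert_subset singletonD)
  have card: "card (V - {v}) = n" using Suc.hyps(2) Suc.prems(1) v by simp
  consider "\<not> cut_connected (V - {v}) R" | "\<not> cut_connected (V - {v}) ?N"
    | "cut_connected (V - {v}) R" "cut_connected (V - {v}) ?N" by blast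
  then show ?case
  proof cases
    case 1
    then show ?thesis using has_induced_P4_if_cut_vertex assms(3) Suc.prems(3) v w by metis
  next
    case 2
    then have "has_induced_P4 V ?N"
      using has_induced_P4_if_cut_vertex[OF symN Suc.prems(4) v w'(1)] w'(2) by auto
    then show ?thesis by (rule has_induced_P4_complement[OF assms(3)])
  next
    case 3
    \<comment> \<open>A neighbour and a non-neighbour of \<open>v\<close> remain, which keeps the
      size at least 2 for the induction hypothesis.\<close>
    have "card {w, w'} \<le> card (V - {v})" using w w' Suc.prems(1) by (intro card_mono) auto
    moreover have "w \<noteq> w'" using w w' by auto
    ultimately have "2 \<le> card (V - {v})" by simp
    then have "has_induced_P4 (V - {v}) R"
      using Suc.hyps(1)[of "V - {v}"] Suc.prems(1) card 3 by simp
    then show ?thesis by (rule has_induced_P4_mono) auto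
  qed
qed auto

lemma co_connected_induced_P4:
  assumes "co_connected G" "graph_order G \<ge> 2"
  obtains a b c d where "{a, b, c, d} \<subseteq> pverts G" "distinct [a, b, c, d]"
    "(a, b) \<in> parcs G" "(b, c) \<in> parcs G" "(c, d) \<in> parcs G"
    "(a, c) \<notin> parcs G" "(b, d) \<notin> parcs G" "(a, d) \<notin> parcs G"
proof -
  interpret pair_graph G using assms(1) by (simp add: co_connected_def)
  let ?R = "\<lambda>x y. (x, y) \<in> parcs G"
  have sym: "symp ?R" using arcs_symmetric by (auto simp: symp_def)
  have "cut_connected (pverts G) ?R"
    unfolding cut_connected_def using co_connected_cut[OF assms(1)] by metis
  moreover have "cut_connected (pverts G) (\<lambda>x y. \<not> ?R x y)"
    unfolding cut_connected_def
    using co_connected_cut[OF co_connected_complement[OF assms(1)]]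
    by (metis in_parcs_complement pverts_complement)
  ultimately have "has_induced_P4 (pverts G) ?R"
    using induced_P4_exists[OF _ _ sym] assms(2) unfolding graph_order_def by simp
  then obtain a b c d where P: "{a, b, c, d} \<subseteq> pverts G"
    "(a, b) \<in> parcs G" "(b, c) \<in> parcs G" "(c, d) \<in> parcs G"
    "(a, c) \<notin> parcs G" "(b, d) \<notin> parcs G" "(a, d) \<notin> parcs G"
    unfolding has_induced_P4_def by auto
  moreover have "distinct [a, b, c, d]" using P arcs_symmetric by auto
  ultimately show ?thesis using that by blast
qed

section \<open>Forcing on graphs with four or five vertices\<close>

context pair_graph begin

lemma psd_step_mono: "B \<subseteq> B' \<Longrightarrow> psd_step G B \<subseteq> psd_step G B'"
  unfolding psd_step_def using psd_forces_mono by blast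

lemma psd_step_subset: "B \<subseteq> pverts G \<Longrightarrow> psd_step G B \<subseteq> pverts G"
  unfolding psd_step_def by (auto simp: psd_forces_iff)

text \<open>Monotonicity lets the second round start from any lower bound \<open>C\<close> of what
  the first round fills.\<close>

lemma fills_in_2I:
  assumes "B \<subseteq> pverts G" "\<And>w. w \<in> C - B \<Longrightarrow> \<exists>v. psd_forces G B v w"
    "\<And>w. w \<in> pverts G - C \<Longrightarrow> \<exists>v. psd_forces G C v w"
  shows "fills_in G (card B) 2"
proof -
  have "C \<subseteq> psd_step G B" using assms(2) unfolding psd_step_def by auto
  then have "psd_step G C \<subseteq> psd_step G (psd_step G B)" by (rule psd_step_mono)
  moreover have "pverts G \<subseteq> psd_step G C" using assms(3) unfolding psd_step_def by auto
  ultimately have "psd_step G (psd_step G B) = pverts G"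
    using psd_step_subset[OF psd_step_subset[OF assms(1)]] by auto
  then have "(psd_step G ^^ 2) B = pverts G" by (simp add: numeral_2_eq_2)
  then show ?thesis using assms(1) unfolding fills_in_def by blast
qed

text \<open>The bounded quantifiers let every premise simplify to finitely many adjacency facts when
  the vertex sets are listed explicitly.\<close>

lemma psd_forcesI_bounded:
  assumes "v \<in> B" "(v, w) \<in> parcs G" "w \<in> W" "W \<subseteq> pverts G - B"
    and "\<forall>x \<in> W. \<forall>y \<in> pverts G - B - W. (x, y) \<notin> parcs G"
    and "\<forall>u \<in> W - {w}. (v, u) \<notin> parcs G"
  shows "psd_forces G B v w"
  using assms(1-4)
proof (rule psd_forcesI)
  show "y \<in> W" if "x \<in> W" "(x, y) \<in> parcs G" "y \<notin> B" for x y
    using assms(5) that in_arcsD2[OF that(2)] by auto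
  show "u = w" if "u \<in> W" "(v, u) \<in> parcs G" for u
    using assms(6) that by auto
qed

lemma adj_commute: "(u, v) \<in> parcs G \<longleftrightarrow> (v, u) \<in> parcs G"
  using arcs_symmetric by blast

lemma fills_in_P4:
  assumes V: "pverts G = {a, b, c, d}" "distinct [a, b, c, d]"
    and E: "(a, b) \<in> parcs G" "(b, c) \<in> parcs G" "(c, d) \<in> parcs G"
    and N: "(a, c) \<notin> parcs G" "(b, d) \<notin> parcs G" "(a, d) \<notin> parcs G"
  shows "fills_in G 1 2"
proof -
  note sym = E[THEN arcs_symmetric] N[unfolded adj_commute[of a] adj_commute[of b]]
  have "psd_forces G {b} b a"
    by (rule psd_forcesI_bounded[where W = "{a}"]) (use V E N sym in auto)
  moreover have "psd_forces G {b} b c"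
    by (rule psd_forcesI_bounded[where W = "{c, d}"]) (use V E N sym in auto)
  moreover have "psd_forces G {a, b, c} c d"
    by (rule psd_forcesI_bounded[where W = "{d}"]) (use V E N sym in auto)
  ultimately have "fills_in G (card {b}) 2"
    using V by (intro fills_in_2I[where C = "{a, b, c}"]) auto
  then show ?thesis by simp
qed

text \<open>The five neighbourhoods of \<open>e\<close> give the path, the fork, the 4-cycle with a
  pendant vertex, the 5-cycle and the bull. Reversing the path and complementing take the remaining
  neighbourhoods, other than the empty and the full one, to these.\<close>

lemma fills_in_P4_extension:
  assumes V: "pverts G = {a, b, c, d, e}" "distinct [a, b, c, d, e]"
    and E: "(a, b) \<in> parcs G" "(b, c) \<in> parcs G" "(c, d) \<in> parcs G"
    and N: "(a, c) \<notin> parcs G" "(b, d) \<notin> parcs G" "(a, d) \<notin> parcs G"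
    and e: "[(e, a) \<in> parcs G, (e, b) \<in> parcs G, (e, c) \<in> parcs G, (e, d) \<in> parcs G] \<in>
      {[True, False, False, False], [False, True, False, False], [True, False, True, False],
       [True, False, False, True], [False, True, True, False]}"
  shows "fills_in G 1 2 \<or> fills_in G 2 1"
proof -
  note sym = E[THEN arcs_symmetric] N[unfolded adj_commute[of a] adj_commute[of b]]
    adj_commute[of a e] adj_commute[of b e] adj_commute[of c e] adj_commute[of d e]
  have "(e, e) \<notin> parcs G" "(a, a) \<notin> parcs G" "(b, b) \<notin> parcs G" "(c, c) \<notin> parcs G" "(d, d) \<notin> parcs G"
    using no_loops' by auto
  note facts = this V(2) E N sym
  consider "(e, a) \<in> parcs G" "(e, b) \<notin> parcs G" "(e, c) \<notin> parcs G" "(e, d) \<notin> parcs G"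
    | "(e, a) \<notin> parcs G" "(e, b) \<in> parcs G" "(e, c) \<notin> parcs G" "(e, d) \<notin> parcs G"
    | "(e, a) \<in> parcs G" "(e, b) \<notin> parcs G" "(e, c) \<in> parcs G" "(e, d) \<notin> parcs G"
    | "(e, a) \<in> parcs G" "(e, b) \<notin> parcs G" "(e, c) \<notin> parcs G" "(e, d) \<in> parcs G"
    | "(e, a) \<notin> parcs G" "(e, b) \<in> parcs G" "(e, c) \<in> parcs G" "(e, d) \<notin> parcs G"
    using e by auto
  then show ?thesis
  proof cases
    case 1
    note adj = facts 1
    have "psd_forces G {b} b a"
      by (rule psd_forcesI_bounded[where W = "{a, e}"]) (use V adj in auto)
    moreover have "psd_forces G {b} b c"
      by (rule psd_forcesI_bounded[where W = "{c, d}"]) (use V adj in auto)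
    moreover have "psd_forces G {a, b, c} c d"
      by (rule psd_forcesI_bounded[where W = "{d}"]) (use V adj in auto)
    moreover have "psd_forces G {a, b, c} a e"
      by (rule psd_forcesI_bounded[where W = "{e}"]) (use V adj in auto)
    ultimately have "fills_in G (card {b}) 2"
      using V by (intro fills_in_2I[where C = "{a, b, c}"]) auto
    then show ?thesis by simp
  next
    case 2
    note adj = facts 2
    have "psd_forces G {b} b a"
      by (rule psd_forcesI_bounded[where W = "{a}"]) (use V adj in auto)
    moreover have "psd_forces G {b} b e"
      by (rule psd_forcesI_bounded[where W = "{e}"]) (use V adj in auto)
    moreover have "psd_forces G {b} b c"
      by (rule psd_forcesI_bounded[where W = "{c, d}"]) (use V adj in auto)
    moreover have "psd_forces G {a, b, c, e} c d"
      by (rule psd_forcesI_bounded[where W = "{d}"]) (use V adj in auto)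
    ultimately have "fills_in G (card {b}) 2"
      using V by (intro fills_in_2I[where C = "{a, b, c, e}"]) auto
    then show ?thesis by simp
  next
    case 3
    note adj = facts 3
    have "psd_forces G {a, c} a b"
      by (rule psd_forcesI_bounded[where W = "{b}"]) (use V adj in auto)
    moreover have "psd_forces G {a, c} a e"
      by (rule psd_forcesI_bounded[where W = "{e}"]) (use V adj in auto)
    moreover have "psd_forces G {a, c} c d"
      by (rule psd_forcesI_bounded[where W = "{d}"]) (use V adj in auto)
    ultimately have "fills_in G (card {a, c}) 1"
      using V by (intro fills_in_1I) auto
    then show ?thesis using V by (simp add: numeral_2_eq_2)
  next
    case 4
    note adj = facts 4
    have "psd_forces G {a, c} a b"
      by (rule psd_forcesI_bounded[where W = "{b}"]) (use V adj in auto)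
    moreover have "psd_forces G {a, c} a e"
      by (rule psd_forcesI_bounded[where W = "{d, e}"]) (use V adj in auto)
    moreover have "psd_forces G {a, c} c d"
      by (rule psd_forcesI_bounded[where W = "{d, e}"]) (use V adj in auto)
    ultimately have "fills_in G (card {a, c}) 1"
      using V by (intro fills_in_1I) auto
    then show ?thesis using V by (simp add: numeral_2_eq_2)
  next
    case 5
    note adj = facts 5
    have "psd_forces G {b, c} b a"
      by (rule psd_forcesI_bounded[where W = "{a}"]) (use V adj in auto)
    moreover have "psd_forces G {b, c} b e"
      by (rule psd_forcesI_bounded[where W = "{e}"]) (use V adj in auto)
    moreover have "psd_forces G {b, c} c d"
      by (rule psd_forcesI_bounded[where W = "{d}"]) (use V adj in auto)
    ultimately have "fills_in G (card {b, c}) 1"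
      using V by (intro fills_in_1I) auto
    then show ?thesis using V by (simp add: numeral_2_eq_2)
  qed
qed

end

lemma fills_in_order_4:
  assumes "co_connected G" "graph_order G = 4"
  shows "fills_in G 1 2"
proof -
  interpret pair_graph G using assms(1) by (simp add: co_connected_def)
  have n2: "graph_order G \<ge> 2" using assms(2) by simp
  obtain a b c d where P: "{a, b, c, d} \<subseteq> pverts G" "distinct [a, b, c, d]"
    "(a, b) \<in> parcs G" "(b, c) \<in> parcs G" "(c, d) \<in> parcs G"
    "(a, c) \<notin> parcs G" "(b, d) \<notin> parcs G" "(a, d) \<notin> parcs G"
    using co_connected_induced_P4[OF assms(1) n2] by blast
  have "card {a, b, c, d} = 4" using P(2) by simp
  then have "pverts G = {a, b, c, d}"
    using card_subset_eq[OF finite_verts P(1)] assms(2) unfolding graph_order_def by simp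
  then show ?thesis using fills_in_P4 P by blast
qed

lemma fills_in_order_5:
  assumes "co_connected G" "graph_order G = 5"
  shows "(fills_in G 1 2 \<or> fills_in G 2 1) \<or>
    (fills_in (complement G) 1 2 \<or> fills_in (complement G) 2 1)"
proof -
  interpret pair_graph G using assms(1) by (simp add: co_connected_def)
  interpret c: pair_graph "complement G" by (rule pair_graph_complement) unfold_locales
  have n2: "graph_order G \<ge> 2" using assms(2) by simp
  obtain a b c d where P: "{a, b, c, d} \<subseteq> pverts G" "distinct [a, b, c, d]"
    and E: "(a, b) \<in> parcs G" "(b, c) \<in> parcs G" "(c, d) \<in> parcs G"
    and N: "(a, c) \<notin> parcs G" "(b, d) \<notin> parcs G" "(a, d) \<notin> parcs G"
    using co_connected_induced_P4[OF assms(1) n2] by blast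
  have "card {a, b, c, d} = 4" using P(2) by simp
  then have "card (pverts G - {a, b, c, d}) = 1"
    using assms(2) P(1) by (simp add: graph_order_def card_Diff_subset)
  then obtain e where e: "pverts G - {a, b, c, d} = {e}" by (auto simp: card_1_singleton_iff)
  have V: "pverts G = {a, b, c, d, e}" "distinct [a, b, c, d, e]" using e P by auto
  note sym = E[THEN arcs_symmetric] N[unfolded adj_commute[of a] adj_commute[of b]]
  have V': "pverts G = {d, c, b, a, e}" "distinct [d, c, b, a, e]"
    "pverts (complement G) = {b, d, a, c, e}" "distinct [b, d, a, c, e]"
    "pverts (complement G) = {c, a, d, b, e}" "distinct [c, a, d, b, e]"
    using V by auto
  have cE: "(b, d) \<in> parcs (complement G)" "(d, a) \<in> parcs (complement G)" "(a, c) \<in> parcs (complement G)"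
    "(b, a) \<notin> parcs (complement G)" "(d, c) \<notin> parcs (complement G)" "(b, c) \<notin> parcs (complement G)"
    using V E N sym by auto
  have cN: "(c, a) \<in> parcs (complement G)" "(a, d) \<in> parcs (complement G)" "(d, b) \<in> parcs (complement G)"
    "(c, d) \<notin> parcs (complement G)" "(a, b) \<notin> parcs (complement G)" "(c, b) \<notin> parcs (complement G)"
    using V E N sym by auto
  \<comment> \<open>The path and its reversal in \<open>G\<close>, the path \<open>b d a c\<close>
    and its reversal in the complement: together they cover all 14 cases in which \<open>e\<close>
    has a neighbour and a non-neighbour among the four.\<close>
  note ext1 = fills_in_P4_extension[OF V E N]
  note ext2 = fills_in_P4_extension[OF V'(1,2) sym(3,2,1) sym(5,4,6)]
  note ext3 = c.fills_in_P4_extension[OF V'(3,4) cE]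
  note ext4 = c.fills_in_P4_extension[OF V'(5,6) cN]
  have ce: "(e, x) \<in> parcs (complement G) \<longleftrightarrow> (e, x) \<notin> parcs G" if "x \<in> {a, b, c, d}" for x
    using that V by auto
  obtain u where u: "(e, u) \<in> parcs G" using co_connected_neighbour[OF assms(1), of e] V n2 by auto
  obtain u' where u': "(e, u') \<in> parcs (complement G)"
    using co_connected_neighbour[OF co_connected_complement[OF assms(1)], of e] V n2 by auto
  have "u \<in> {a, b, c, d}" using in_arcsD2[OF u] no_loops'[OF u] V(1) by auto
  then have some: "(e, a) \<in> parcs G \<or> (e, b) \<in> parcs G \<or> (e, c) \<in> parcs G \<or> (e, d) \<in> parcs G"
    using u by auto
  have "u' \<in> {a, b, c, d}" using u' V(1) by auto
  then have not_all: "\<not> ((e, a) \<in> parcs G \<and> (e, b) \<in> parcs G \<and> (e, c) \<in> parcs G \<and> (e, d) \<in> parcs G)"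
    using u' by auto
  show ?thesis
    using ext1 ext2 ext3 ext4 some not_all ce[of a] ce[of b] ce[of c] ce[of d]
    by (cases "(e, a) \<in> parcs G"; cases "(e, b) \<in> parcs G"; cases "(e, c) \<in> parcs G";
        cases "(e, d) \<in> parcs G") (simp_all del: in_parcs_complement)
qed


section \<open>Bounds for throttling numbers\<close>

text \<open>The constant 1 serves as the o(n) and o(n^2) term in the upper bounds.\<close>

lemma is_little_o_1: "is_little_o (\<lambda>n. 1) (\<lambda>n. real n)" "is_little_o (\<lambda>n. 1) (\<lambda>n. real n ^ 2)"
  unfolding is_little_o_def by (auto, real_asymp+)

text \<open>Expansion of \<open>(a - c) * (b - c) \<ge> 0\<close>; it turns lower bounds on sums
  into lower bounds on products.\<close>

lemma mult_ge_if_both_ge: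
  fixes a b c :: nat
  assumes "c \<le> a" "c \<le> b" shows "c * a + c * b \<le> a * b + c * c"
proof -
  have "0 \<le> (int a - int c) * (int b - int c)" using assms by simp
  then have "int (c * a + c * b) \<le> int (a * b + c * c)" by (simp add: algebra_simps)
  then show ?thesis by (simp only: of_nat_le_iff)
qed

context
  fixes G :: "'a pair_pre_digraph" and n :: nat
  assumes co: "co_connected G" and n: "graph_order G = n" and n4: "n \<ge> 4"
begin

lemma complement_facts:
  "co_connected (complement G)" "graph_order (complement G) = n" "complement (complement G) = G"
  using co n co_connected_complement complement_complement by (auto simp: co_connected_def)

lemmas th_plus_both = th_plus_bounds[OF co n n4]
  th_plus_bounds[OF complement_facts(1,2) n4, unfolded complement_facts(3)]

lemmas th_star_both = th_star_bounds[OF co n n4]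
  th_star_bounds[OF complement_facts(1,2) n4, unfolded complement_facts(3)]

lemmas th_times_both = th_times_bounds[OF co n n4]
  th_times_bounds[OF complement_facts(1,2) n4, unfolded complement_facts(3)]

lemma ng_sum_th_plus: "n \<le> ng_sum th_plus G" "ng_sum th_plus G + 2 \<le> 2 * n"
  using th_plus_both n4 unfolding ng_sum_def by linarith+

lemma ng_prod_th_plus_upper: "ng_prod th_plus G \<le> (n - 1)\<^sup>2"
  unfolding ng_prod_def power2_eq_square using th_plus_both by (intro mult_le_mono)

lemma ng_prod_th_plus_lower:
  "9 \<le> ng_prod th_plus G" "n \<noteq> 5 \<Longrightarrow> 2 * n \<le> ng_prod th_plus G \<and> 3 * n \<le> ng_prod th_plus G + 9"
proof -
  let ?a = "th_plus G" and ?b = "th_plus (complement G)"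
  have "3 * 3 \<le> ?a * ?b" using th_plus_both by (intro mult_le_mono)
  then show "9 \<le> ng_prod th_plus G" by (simp add: ng_prod_def)
  assume n5: "n \<noteq> 5"
  have "2 * n \<le> ?a * ?b \<and> 3 * n \<le> ?a * ?b + 9"
  proof -
    consider "?a = 3" | "?b = 3" | "?a \<ge> 4" "?b \<ge> 4" using th_plus_both by linarith
    then show ?thesis
    proof cases
      case 1
      \<comment> \<open>The product is at least \<open>3 * (n - 2)\<close>, which reaches
        \<open>2 * n\<close> from \<open>n = 6\<close> on, while 9 suffices at \<open>n = 4\<close>;
        this is why \<open>n = 5\<close> is excluded.\<close>
      then have "n \<le> ?b + 2" using th_plus_both by simp
      then show ?thesis using 1 n5 n4 th_plus_both by simp
    next
      case 2
      then have "n \<le> ?a + 2" using th_plus_both by simp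
      then show ?thesis using 2 n5 n4 th_plus_both by simp
    next
      case 3
      define m where "m = ?a * ?b"
      \<comment> \<open>This yields \<open>4 * n - 16\<close>, enough for \<open>n \<ge> 8\<close>;
        the bound 16 settles \<open>n \<le> 8\<close>.\<close>
      have "4 * ?a + 4 * ?b \<le> m + 16" using mult_ge_if_both_ge[OF 3] by (simp add: m_def)
      moreover have "16 \<le> m" using mult_le_mono[OF 3] by (simp add: m_def)
      ultimately have "2 * n \<le> m \<and> 3 * n \<le> m + 9" using th_plus_both(3) by (intro conjI) linarith+
      then show ?thesis by (simp add: m_def)
    qed
  qed
  then show "2 * n \<le> ng_prod th_plus G \<and> 3 * n \<le> ng_prod th_plus G + 9" by (simp add: ng_prod_def)
qed

lemma order_5_upper:
  assumes "n = 5" shows "ng_prod th_plus G \<le> 12" "ng_prod th_times G \<le> 20"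
proof -
  have small: "th_plus H \<le> 3 \<and> th_times H \<le> 4"
    if "co_connected H" "graph_order H = 5" "fills_in H 1 2 \<or> fills_in H 2 1" for H :: "'a pair_pre_digraph"
    using that(3) th_plus_le[OF co_connected_parcs(3,4)[OF that(1)], of 1 2]
      th_plus_le[OF co_connected_parcs(3,4)[OF that(1)], of 2 1]
      th_times_le[OF co_connected_parcs(3,4)[OF that(1)], of 1 2]
      th_times_le[OF co_connected_parcs(3,4)[OF that(1)], of 2 1] that(2) by auto
  have "(th_plus G \<le> 3 \<and> th_times G \<le> 4) \<or> (th_plus (complement G) \<le> 3 \<and> th_times (complement G) \<le> 4)"
    using fills_in_order_5[OF co] small[OF co] small[OF complement_facts(1)] n assms by auto
  moreover have "th_plus G \<le> 4" "th_plus (complement G) \<le> 4" "th_times G \<le> 5" "th_times (complement G) \<le> 5"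
    using th_plus_both th_times_both assms by auto
  ultimately have "ng_prod th_plus G \<le> 3 * 4 \<or> ng_prod th_plus G \<le> 4 * 3"
    "ng_prod th_times G \<le> 4 * 5 \<or> ng_prod th_times G \<le> 5 * 4"
    unfolding ng_prod_def by (meson mult_le_mono)+
  then show "ng_prod th_plus G \<le> 12" "ng_prod th_times G \<le> 20" by auto
qed

lemma ng_sum_th_star: "n \<le> ng_sum th_star G + 2" "ng_sum th_star G + 4 \<le> 2 * n"
  using th_star_both n4 unfolding ng_sum_def by linarith+

lemma ng_prod_th_star_upper: "ng_prod th_star G \<le> (n - 2)\<^sup>2"
  unfolding ng_prod_def power2_eq_square using th_star_both by (intro mult_le_mono)

lemma ng_prod_th_star_lower: "n \<le> ng_prod th_star G + 1" "2 * n \<le> ng_prod th_star G + 8"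
proof -
  let ?a = "th_star G" and ?b = "th_star (complement G)"
  have "2 * ?a + 2 * ?b \<le> ?a * ?b + 2 * 2" using th_star_both by (intro mult_ge_if_both_ge)
  then show le: "2 * n \<le> ng_prod th_star G + 8" using th_star_both(3) unfolding ng_prod_def by simp
  have "4 \<le> ?a * ?b" using mult_le_mono[of 2 ?a 2 ?b] th_star_both by simp
  \<comment> \<open>Only at \<open>n = 6\<close> do both 4 and \<open>2 * n - 8\<close> fall short
    of \<open>n - 1\<close>.\<close>
  moreover have "5 \<le> ?a * ?b" if "n = 6"
  proof -
    have "?a \<ge> 3 \<or> ?b \<ge> 3" using that th_star_both by linarith
    then have "3 * 2 \<le> ?a * ?b \<or> 2 * 3 \<le> ?a * ?b" using th_star_both by (meson mult_le_mono)
    then show ?thesis by auto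
  qed
  ultimately show "n \<le> ng_prod th_star G + 1" using le unfolding ng_prod_def by linarith
qed

lemma ng_sum_th_times: "n \<le> ng_sum th_times G" "ng_sum th_times G \<le> 2 * n"
  using th_times_both(2,3,7) n4 unfolding ng_sum_def by (linarith, linarith)

lemma ng_prod_th_times_upper: "ng_prod th_times G \<le> n\<^sup>2"
  unfolding ng_prod_def power2_eq_square using th_times_both(2,7) by (intro mult_le_mono)

lemma ng_prod_th_times_lower: "n \<ge> 6 \<Longrightarrow> 3 * n \<le> ng_prod th_times G" "n = 5 \<Longrightarrow> 12 \<le> ng_prod th_times G"
proof -
  let ?a = "th_times G" and ?b = "th_times (complement G)"
  have three: "?a = 3 \<Longrightarrow> ?b = n \<or> 2 * n \<le> ?b + 6" "?b = 3 \<Longrightarrow> ?a = n \<or> 2 * n \<le> ?a + 6"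
    by (fact th_times_both(4), fact th_times_both(9))
  define m where "m = ?a * ?b"
  have four: "4 * ?a + 4 * ?b \<le> m + 16" "16 \<le> m" if "?a \<ge> 4" "?b \<ge> 4"
    using that mult_ge_if_both_ge[of 4 ?a ?b] mult_le_mono[of 4 ?a 4 ?b] by (auto simp: m_def)
  have cases: thesis if "?a = 3 \<Longrightarrow> thesis" "?b = 3 \<Longrightarrow> thesis" "?a \<ge> 4 \<Longrightarrow> ?b \<ge> 4 \<Longrightarrow> thesis" for thesis
    using that th_times_both(1,6) by linarith
  show "3 * n \<le> ng_prod th_times G" if n6: "n \<ge> 6"
    unfolding ng_prod_def
  proof (cases rule: cases)
    case 1
    then show "3 * n \<le> ?a * ?b" using three(1) n6 by auto
  next
    case 2
    then show "3 * n \<le> ?a * ?b" using three(2) n6 by auto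
  next
    case 3
    consider "?a = n" | "?b = n" | "2 * n \<le> ?a + ?b + 4" using th_times_both(3) by blast
    then show "3 * n \<le> ?a * ?b"
    proof cases
      case 1
      then show ?thesis using mult_le_mono[of n ?a 3 ?b] 3 by simp
    next
      case 2
      then show ?thesis using mult_le_mono[of 3 ?a n ?b] 3 by simp
    next
      case sum: 3
      show ?thesis
      \<comment> \<open>The sum bound gives \<open>8 * n - 32\<close>, at least \<open>3 * n\<close>
        for \<open>n \<ge> 7\<close>; at \<open>n = 6\<close> the case of two factors 4 has to be
        excluded.\<close>
      proof (cases "n = 6")
        case True
        then have "?a \<ge> 5 \<or> ?b \<ge> 5" using 3 th_times_both(5) by linarith
        then have "4 * 5 \<le> ?a * ?b \<or> 5 * 4 \<le> ?a * ?b" using 3 by (meson mult_le_mono)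
        then show ?thesis using True by auto
      next
        case False
        then have "3 * n \<le> m" using four[OF 3] sum n6 by linarith
        then show ?thesis by (simp add: m_def)
      qed
    qed
  qed
  show "12 \<le> ng_prod th_times G" if n5: "n = 5"
    unfolding ng_prod_def
  proof (cases rule: cases)
    case 1
    then show "12 \<le> ?a * ?b" using three(1) n5 by auto
  next
    case 2
    then show "12 \<le> ?a * ?b" using three(2) n5 by auto
  next
    case 3
    then show "12 \<le> ?a * ?b" using four(2)[OF 3] by (simp add: m_def)
  qed
qed

lemma order_4_ng_prod_th_times:
  assumes "n = 4" shows "ng_prod th_times G = 9"
proof -
  have "th_times H \<le> 3" if "co_connected H" "graph_order H = 4" for H :: "'a pair_pre_digraph"
    using fills_in_order_4[OF that] th_times_le[OF co_connected_parcs(3,4)[OF that(1)], of 1 2] that(2) by auto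
  then have "th_times G \<le> 3" "th_times (complement G) \<le> 3"
    using co complement_facts n assms by auto
  then have "th_times G = 3" "th_times (complement G) = 3" using th_times_both(1,6) by linarith+
  then show ?thesis by (simp add: ng_prod_def)
qed

end


section \<open>Almost sharp lower bounds: brooms\<close>

lemma digraph_iso_graph_order:
  assumes "digraph_iso (with_proj G) (with_proj H)"
  shows "graph_order G = graph_order H"
proof -
  obtain f where f: "pre_digraph.digraph_isomorphism (with_proj G) f" "with_proj H = app_iso f (with_proj G)"
    using assms unfolding digraph_iso_def by auto
  have "pverts H = iso_verts f ` pverts G"
    using arg_cong[OF f(2), of verts] by (simp add: verts_app_iso)
  moreover have "inj_on (iso_verts f) (pverts G)"
    using f(1) by (simp add: pre_digraph.digraph_isomorphism_def)
  ultimately show ?thesis by (simp add: graph_order_def card_image)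
qed

text \<open>Graphs of different order are not isomorphic, so a family with one graph per order
  suffices.\<close>

lemma infinitely_many_graphsI:
  fixes F :: "nat \<Rightarrow> nat pair_pre_digraph"
  assumes "infinite S" "inj_on (\<lambda>i. graph_order (F i)) S" "\<And>i. i \<in> S \<Longrightarrow> P (F i)"
  shows "infinitely_many_graphs P"
  unfolding infinitely_many_graphs_def
proof (intro exI[of _ "F ` S"] conjI ballI impI)
  have "inj_on F S" by (rule inj_on_imageI2[of graph_order]) (use assms(2) in \<open>simp add: comp_def\<close>)
  then show "infinite (F ` S)" using assms(1) by (simp add: finite_image_iff)
  show "P G" if "G \<in> F ` S" for G using that assms(3) by auto
  show "\<not> digraph_iso (with_proj G) (with_proj H)" if "G \<in> F ` S" "H \<in> F ` S" "G \<noteq> H" for G H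
    using that assms(2) digraph_iso_graph_order by (auto dest: inj_onD)
qed

lemma (in pair_graph) connected_if_root:
  assumes "r \<in> pverts G" "\<And>v. v \<in> pverts G \<Longrightarrow> (r, v) \<in> rtrancl_on (pverts G) (parcs G)"
  shows "Digraph_Component.connected (with_proj G)"
  unfolding connected_iff[OF pair_graph]
proof (intro conjI ballI)
  fix u v assume "u \<in> pverts G" "v \<in> pverts G"
  then have "(u, r) \<in> rtrancl_on (pverts G) (parcs G)" "(r, v) \<in> rtrancl_on (pverts G) (parcs G)"
    using assms(2) rtrancl_on_sym by auto
  then show "(u, v) \<in> rtrancl_on (pverts G) (parcs G)" by (rule rtrancl_on_trans)
qed (use assms(1) in auto)

lemma rtrancl_on_step: "(u, v) \<in> r \<Longrightarrow> u \<in> U \<Longrightarrow> v \<in> U \<Longrightarrow> (u, v) \<in> rtrancl_on U r"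
  by (meson rtrancl_on_into_rtrancl_on rtrancl_on_refl)

lemma pair_graphI:
  assumes "finite (pverts G)" "\<And>u v. (u, v) \<in> parcs G \<Longrightarrow> u \<in> pverts G \<and> v \<in> pverts G \<and> u \<noteq> v \<and> (v, u) \<in> parcs G"
  shows "pair_graph G"
proof -
  have "finite (parcs G)"
    by (rule finite_subset[of _ "pverts G \<times> pverts G"]) (use assms in auto)
  then show ?thesis
    using assms by unfold_locales (auto simp: symmetric_def sym_def)
qed

text \<open>The star with centre 0 and one of its edges, from 0 to 1, extended by the vertex 2.\<close>

definition broom :: "nat \<Rightarrow> nat pair_pre_digraph" where
  "broom n = \<lparr> pverts = {..<n}, parcs = {(0, 1), (1, 0), (1, 2), (2, 1)} \<union>
     {0} \<times> {3..<n} \<union> {3..<n} \<times> {0} \<rparr>"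

context
  fixes n :: nat
  assumes n4: "n \<ge> 4"
begin

lemma broom_simps [simp]:
  "pverts (broom n) = {..<n}"
  "(u, v) \<in> parcs (broom n) \<longleftrightarrow> (u, v) \<in> {(0, 1), (1, 0), (1, 2), (2, 1)} \<or>
     u = 0 \<and> 3 \<le> v \<and> v < n \<or> v = 0 \<and> 3 \<le> u \<and> u < n"
  "graph_order (broom n) = n"
  by (auto simp: broom_def graph_order_def)

lemma pair_graph_broom: "pair_graph (broom n)"
  by (rule pair_graphI) (use n4 in auto)

lemma co_connected_broom: "co_connected (broom n)"
proof -
  interpret pair_graph "broom n" by (rule pair_graph_broom)
  interpret c: pair_graph "complement (broom n)" by (rule pair_graph_complement) unfold_locales
  have "Digraph_Component.connected (with_proj (broom n))"
  proof (rule connected_if_root[of 0])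
    show "(0, v) \<in> rtrancl_on (pverts (broom n)) (parcs (broom n))" if "v \<in> pverts (broom n)" for v
    proof (cases "v = 2")
      case True
      have "(0, 1) \<in> rtrancl_on (pverts (broom n)) (parcs (broom n))"
        using n4 by (intro rtrancl_on_step) auto
      then show ?thesis by (rule rtrancl_on_into_rtrancl_on) (use True n4 in auto)
    next
      case False
      show ?thesis
      proof (cases "v = 0")
        case v0: False
        show ?thesis by (rule rtrancl_on_step) (use False v0 that n4 in auto)
      qed (use n4 in auto)
    qed
  qed (use n4 in auto)
  moreover have "Digraph_Component.connected (with_proj (complement (broom n)))"
  proof (rule c.connected_if_root[of 2])
    show "(2, v) \<in> rtrancl_on (pverts (complement (broom n))) (parcs (complement (broom n)))"
      if "v \<in> pverts (complement (broom n))" for v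
    proof (cases "v = 1")
      case True
      have "(2, 3) \<in> rtrancl_on (pverts (complement (broom n))) (parcs (complement (broom n)))"
        using n4 by (intro rtrancl_on_step) auto
      then show ?thesis by (rule rtrancl_on_into_rtrancl_on) (use True n4 in auto)
    next
      case False
      show ?thesis
      proof (cases "v = 2")
        case v2: False
        show ?thesis by (rule rtrancl_on_step) (use False v2 that n4 in auto)
      qed (use n4 in auto)
    qed
  qed (use n4 in auto)
  ultimately show ?thesis using pair_graph_broom by (simp add: co_connected_def)
qed

lemma fills_in_broom: "fills_in (broom n) 1 2"
proof -
  interpret pair_graph "broom n" by (rule pair_graph_broom)
  have "\<exists>v. psd_forces (broom n) {0} v w" if w: "w \<in> {..<n} - {2} - {0}" for w
  proof (cases "w = 1")
    case True
    have "psd_forces (broom n) {0} 0 1"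
      by (rule psd_forcesI_bounded[where W = "{1, 2}"]) (use n4 in auto)
    then show ?thesis using True by blast
  next
    case False
    have "psd_forces (broom n) {0} 0 w"
      by (rule psd_forcesI_bounded[where W = "{w}"]) (use n4 w False in auto)
    then show ?thesis by blast
  qed
  moreover have "psd_forces (broom n) ({..<n} - {2}) 1 2"
    by (rule psd_forcesI_bounded[where W = "{2}"]) (use n4 in auto)
  ultimately have "fills_in (broom n) (card {0 :: nat}) 2"
    using n4 by (intro fills_in_2I[where C = "{..<n} - {2}"]) auto
  then show ?thesis by simp
qed

text \<open>Otherwise three vertices of the broom would have degree at least 2, but all except 0 and
  1 are leaves.\<close>

lemma not_fills_in_complement_broom: "\<not> fills_in (complement (broom n)) (n - 3) 1"
proof
  interpret pair_graph "broom n" by (rule pair_graph_broom)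
  assume "fills_in (complement (broom n)) (n - 3) 1"
  from fills_in_complement_1_degree[OF this] obtain D where D: "D \<subseteq> {..<n}" "card D = n - (n - 3)"
    "\<And>w. w \<in> D \<Longrightarrow> card D - 1 \<le> card {y. (w, y) \<in> parcs (broom n)}"
    by auto
  have card: "card D = 3" using D(2) n4 by simp
  have "D \<subseteq> {0, 1}"
  proof
    fix w assume w: "w \<in> D"
    show "w \<in> {0, 1}"
    proof (rule ccontr)
      assume "w \<notin> {0, 1}"
      then have "{y. (w, y) \<in> parcs (broom n)} \<subseteq> {if w = 2 then 1 else 0}" by auto
      then have "card {y. (w, y) \<in> parcs (broom n)} \<le> card {if w = 2 then 1 else 0 :: nat}"
        by (intro card_mono) simp
      then show False using D(3)[OF w] card by (simp del: broom_simps)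
    qed
  qed
  then have "card D \<le> card {0 :: nat, 1}" by (intro card_mono) auto
  then show False using card by simp
qed

text \<open>The broom is filled from one vertex, so \<open>l \<ge> n - 3\<close>, and equality costs
  a second round. Hence \<open>l + s \<ge> n - 1\<close> and, for \<open>l < n\<close>, also
  \<open>l * s \<ge> n - 2\<close>.\<close>

lemma fills_in_complement_broom:
  assumes "fills_in (complement (broom n)) l s" "l \<ge> 1"
  shows "l = n \<or> l < n \<and> (n \<le> l + 2 \<and> 1 \<le> s \<or> l + 3 = n \<and> 2 \<le> s)"
proof -
  note f = fills_in_both[OF co_connected_broom _ n4 fills_in_broom _ assms, simplified]
  show ?thesis
  proof (cases "l + 3 = n")
    case True
    then have "l = n - 3" by simp
    then have "s \<noteq> 1" using not_fills_in_complement_broom assms(1) by auto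
    then show ?thesis using f True by linarith
  next
    case False
    then show ?thesis using f by linarith
  qed
qed

lemma complement_broom_facts:
  "co_connected (complement (broom n))" "graph_order (complement (broom n)) = n"
  using co_connected_complement[OF co_connected_broom] by auto

lemma broom_order_ge_2: "2 \<le> graph_order (broom n)" "2 \<le> graph_order (complement (broom n))"
  using n4 by auto

lemmas broom_parcs = co_connected_parcs[OF co_connected_broom broom_order_ge_2(1)]
lemmas complement_broom_parcs = co_connected_parcs[OF complement_broom_facts(1) broom_order_ge_2(2)]

lemma th_plus_broom: "th_plus (broom n) = 3" "th_plus (complement (broom n)) = n - 1"
proof -
  have "th_plus (broom n) \<le> 1 + 2"
    by (rule th_plus_le[OF broom_parcs(3,4) fills_in_broom]) simp
  then show "th_plus (broom n) = 3"
    using th_plus_bounds(1)[OF co_connected_broom _ n4] by simp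
  obtain l s where l: "1 \<le> l" "fills_in (complement (broom n)) l s" "th_plus (complement (broom n)) = l + s"
    using th_plus_attained[OF complement_broom_parcs(3,4)] by blast
  then have "n - 1 \<le> th_plus (complement (broom n))"
    using fills_in_complement_broom[OF l(2,1)] by linarith
  then show "th_plus (complement (broom n)) = n - 1"
    using th_plus_bounds(2)[OF complement_broom_facts n4] by simp
qed

lemma th_star_broom: "th_star (broom n) = 2" "th_star (complement (broom n)) = n - 2"
proof -
  have "th_star (broom n) \<le> 1 * 2"
    by (rule th_star_le[OF broom_parcs(1,2) fills_in_broom]) (use n4 in simp_all)
  then show "th_star (broom n) = 2"
    using th_star_bounds(1)[OF co_connected_broom _ n4] by simp
  obtain l s where l: "1 \<le> l" "l < n" "fills_in (complement (broom n)) l s" "th_star (complement (broom n)) = l * s"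
    using th_star_attained[OF complement_broom_parcs(1,2)] unfolding complement_broom_facts(2) by blast
  have "n - 2 \<le> l * s"
  proof (cases "n \<le> l + 2")
    case True
    then have "(n - 2) * 1 \<le> l * s"
      using fills_in_complement_broom[OF l(3,1)] l(2) by (intro mult_le_mono) auto
    then show ?thesis by simp
  next
    case False
    then have "(n - 3) * 2 \<le> l * s"
      using fills_in_complement_broom[OF l(3,1)] l(2) by (intro mult_le_mono) auto
    then show ?thesis using n4 by linarith
  qed
  then show "th_star (complement (broom n)) = n - 2"
    using th_star_bounds(2)[OF complement_broom_facts n4] l(4) by simp
qed

lemma th_times_broom:
  assumes "n \<ge> 6"
  shows "th_times (broom n) = 3" "th_times (complement (broom n)) = n"
proof -
  have "th_times (broom n) \<le> 1 * (1 + 2)"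
    by (rule th_times_le[OF broom_parcs(3,4) fills_in_broom]) simp
  then show *: "th_times (broom n) = 3"
    using th_times_bounds(1)[OF co_connected_broom _ n4] by simp
  \<comment> \<open>The alternative lower bound \<open>2 * n - 6\<close> is at least
    \<open>n\<close> precisely from order 6 on.\<close>
  show "th_times (complement (broom n)) = n"
    using th_times_bounds(4)[OF co_connected_broom _ n4 *] assms
      th_times_bounds(2)[OF complement_broom_facts n4] by (simp, linarith)
qed

end

text \<open>From order 9 on, \<open>3 * n - 9 \<ge> 2 * n\<close>, which settles the maximum in the
  \<open>th_plus\<close> product bound.\<close>

lemma infinitely_many_brooms:
  assumes "\<And>n. n \<ge> 9 \<Longrightarrow> P (broom n)" shows "infinitely_many_graphs P"
proof (rule infinitely_many_graphsI)
  show "infinite {9 :: nat..}" by (rule infinite_Ici)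
  show "inj_on (\<lambda>n. graph_order (broom n)) {9..}" by (rule inj_onI) simp
qed (use assms in auto)

lemma almost_sharp_if_broom:
  assumes "0 < k" "k < 10" "\<And>n. n \<ge> 9 \<Longrightarrow> int (Z (broom n)) = b n + k"
  shows "almost_sharp Z b"
  unfolding almost_sharp_def
  using assms co_connected_broom by (intro exI[of _ k] conjI infinitely_many_brooms) auto

lemma almost_sharp_brooms:
  "almost_sharp (ng_sum th_plus) (\<lambda>n. int n)"
  "almost_sharp (ng_prod th_plus) (\<lambda>n. max (2 * int n) (3 * int n - 9))"
  "almost_sharp (ng_sum th_star) (\<lambda>n. int n - 2)"
  "almost_sharp (ng_prod th_star) (\<lambda>n. max (int n - 1) (2 * int n - 8))"
  "almost_sharp (ng_sum th_times) (\<lambda>n. int n)"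
  \<comment> \<open>The gaps 2, 6, 2, 4, 3 come from the values (3, n - 1), (2, n - 2) and (3, n) of
    the broom and its complement.\<close>
  using almost_sharp_if_broom[of 2 "ng_sum th_plus"] almost_sharp_if_broom[of 6 "ng_prod th_plus"]
    almost_sharp_if_broom[of 2 "ng_sum th_star"] almost_sharp_if_broom[of 4 "ng_prod th_star"]
    almost_sharp_if_broom[of 3 "ng_sum th_times"]
  by (simp_all add: ng_sum_def ng_prod_def th_plus_broom th_star_broom th_times_broom of_nat_diff)

lemma sharp_brooms: "sharp (ng_prod th_times) (\<lambda>n. 3 * int n)"
  unfolding sharp_def ng_prod_def
  by (intro infinitely_many_brooms) (simp add: co_connected_broom th_times_broom)


section \<open>Polarity graphs\<close>

lemma (in pair_graph) connected_set_component_of: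
  assumes "w \<in> pverts G - F" shows "connected_set G (component_of G F w)"
proof -
  let ?C = "component_of G F w"
  have from_w: "(w, u) \<in> rtrancl_on ?C (parcs G)" if "u \<in> ?C" for u
  proof -
    have "(w, u) \<in> rtrancl_on (pverts G - F) (parcs G)" using that by (simp add: component_of_def)
    then show ?thesis
    proof (induction rule: rtrancl_on_induct)
      case base
      show ?case using self_in_component_of[OF assms] by simp
    next
      case (step y z)
      then have "z \<in> ?C" using rtrancl_on_into_rtrancl_on unfolding component_of_def by fast
      with step show ?case by (auto intro: rtrancl_on_into_rtrancl_on)
    qed
  qed
  show ?thesis
    unfolding connected_set_def
  proof (intro ballI)
    fix x y assume "x \<in> ?C" "y \<in> ?C"
    then have "(x, w) \<in> rtrancl_on ?C (parcs G)" "(w, y) \<in> rtrancl_on ?C (parcs G)"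
      using from_w rtrancl_on_sym by auto
    then show "(x, y) \<in> rtrancl_on ?C (parcs G)" by (rule rtrancl_on_trans)
  qed
qed

text \<open>The connected sets of at least \<open>s\<close> vertices form a bramble. If a set hits all of them, the
  remaining components have fewer than \<open>s\<close> vertices and can be distributed to two sides of at
  least \<open>s\<close> vertices each, unless fewer than \<open>3 * s\<close> vertices remain.\<close>

lemma fills_in_ge_if_no_empty_pair:
  assumes G: "pair_graph G" and "fills_in G k t" "s \<ge> 1"
    and pair: "\<And>A C. A \<subseteq> pverts G \<Longrightarrow> C \<subseteq> pverts G \<Longrightarrow> A \<inter> C = {} \<Longrightarrow> s \<le> card A \<Longrightarrow> s \<le> card C \<Longrightarrow>
      \<exists>x \<in> A. \<exists>y \<in> C. (x, y) \<in> parcs G"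
  shows "graph_order G \<le> k + 3 * s"
proof (rule ccontr)
  assume big: "\<not> graph_order G \<le> k + 3 * s"
  interpret pair_graph G by fact
  let ?V = "pverts G"
  obtain B where B: "B \<subseteq> ?V" "card B = k" "psd_reaches G B ?V"
    using fills_in_psd_reaches[OF G assms(2)] .
  define \<B> where "\<B> = {X. X \<subseteq> ?V \<and> connected_set G X \<and> s \<le> card X}"
  have bramble: "X \<subseteq> ?V \<and> X \<noteq> {} \<and> connected_set G X" if "X \<in> \<B>" for X
    using that assms(3) unfolding \<B>_def by auto
  have touch: "touching G X Y" if "X \<in> \<B>" "Y \<in> \<B>" for X Y
    using that pair[of X Y] unfolding \<B>_def touching_def by auto
  obtain T where T: "T \<subseteq> ?V" "card T \<le> k + 1" "\<And>X. X \<in> \<B> \<Longrightarrow> X \<inter> T \<noteq> {}"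
    using bramble_hitting_set[OF B(3,1) bramble touch] B(2) by auto
  define U where "U = ?V - T"
  have finU: "finite U" unfolding U_def using finite_verts by simp
  have "card U = graph_order G - card T"
    using T(1) finite_verts unfolding U_def graph_order_def by (simp add: card_Diff_subset finite_subset)
  then have cardU: "3 * s \<le> card U" using big T(2) by linarith
  \<comment> \<open>Closed sets are unions of components of the graph on \<open>U\<close>; among
    those with at least \<open>s\<close> vertices a smallest one is taken.\<close>
  define closed where "closed A \<longleftrightarrow> A \<subseteq> U \<and> (\<forall>x \<in> A. \<forall>y \<in> U - A. (x, y) \<notin> parcs G) \<and> s \<le> card A" for A
  have "closed U" using cardU unfolding closed_def by auto
  then obtain A where A: "closed A" and least: "\<And>A'. closed A' \<Longrightarrow> card A \<le> card A'"
    using ex_has_least_nat[of closed U card] by auto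
  have AU: "A \<subseteq> U" "finite A" using A finU finite_subset unfolding closed_def by auto
  obtain w where w: "w \<in> A" using A assms(3) unfolding closed_def by fastforce
  define C where "C = component_of G T w"
  have wU: "w \<in> ?V - T" using w AU(1) unfolding U_def by auto
  have CU: "C \<subseteq> U" unfolding C_def U_def by (rule component_of_subset)
  have CA: "C \<subseteq> A"
  proof
    fix u assume "u \<in> C"
    then have "(w, u) \<in> rtrancl_on U (parcs G)" by (simp add: C_def component_of_def U_def)
    then show "u \<in> A"
    proof (induction rule: rtrancl_on_induct)
      case (step y z)
      then show ?case using A unfolding closed_def by blast
    qed (rule w)
  qed
  have "C \<inter> T = {}" using CU unfolding U_def by auto
  then have "C \<notin> \<B>" using T(3) by blast
  then have cardC: "card C < s"
    using connected_set_component_of[OF wU] CU unfolding \<B>_def C_def U_def by auto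
  have "(x, y) \<notin> parcs G" if x: "x \<in> A - C" and y: "y \<in> U - (A - C)" for x y
  proof
    assume xy: "(x, y) \<in> parcs G"
    show False
    proof (cases "y \<in> A")
      case True
      then have "y \<in> C" using y by auto
      moreover have "x \<in> ?V - T" using x AU(1) unfolding U_def by auto
      ultimately have "x \<in> C" using component_of_closed[of y G T w x] arcs_symmetric[OF xy] unfolding C_def by auto
      then show False using x by simp
    next
      case False
      then show False using A x y xy unfolding closed_def by auto
    qed
  qed
  \<comment> \<open>By minimality, deleting the small component \<open>C\<close> leaves fewer than
    \<open>s\<close> vertices; so \<open>card A < 2 * s\<close>, and at least \<open>s\<close> of
    the \<open>3 * s\<close> vertices stay outside \<open>A\<close>.\<close>
  moreover have "card (A - C) < card A"
    using w self_in_component_of[OF wU] AU(2) unfolding C_def by (intro psubset_card_mono) auto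
  ultimately have "card (A - C) < s"
    using least[of "A - C"] AU(1) unfolding closed_def by fastforce
  then have "card A < 2 * s"
    using cardC CA AU(2) card_Diff_subset[of C A] finite_subset[OF CA AU(2)] by linarith
  moreover have "card (U - A) = card U - card A" using AU by (simp add: card_Diff_subset)
  ultimately have "s \<le> card (U - A)" using cardU by linarith
  then obtain x y where "x \<in> A" "y \<in> U - A" "(x, y) \<in> parcs G"
    using pair[of A "U - A"] A AU(1) unfolding closed_def U_def by blast
  then show False using A unfolding closed_def by blast
qed

text \<open>The vertex \<open>x\<close> stands for the point \<open>(x div p, x mod p)\<close> of the affine plane over the
  integers modulo \<open>p\<close>, and \<open>(a, b)\<close> is incident with \<open>(c, d)\<close> iff \<open>b + d = a * c\<close>.\<close>

definition incident :: "nat \<Rightarrow> nat \<Rightarrow> nat \<Rightarrow> bool" where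
  "incident p x y \<longleftrightarrow> int p dvd int (x mod p) + int (y mod p) - int (x div p) * int (y div p)"

text \<open>Modulo \<open>p\<close>, \<open>incident\<close> says that the point (a, b) lies on the
  line y = c x - d. Its symmetry lets one vertex stand for both a point and a line; self-incident
  vertices get no loop.\<close>

definition polarity_graph :: "nat \<Rightarrow> nat pair_pre_digraph" where
  "polarity_graph p = \<lparr> pverts = {..<p * p},
     parcs = {(x, y). x < p * p \<and> y < p * p \<and> x \<noteq> y \<and> incident p x y} \<rparr>"

lemma incident_commute: "incident p x y \<longleftrightarrow> incident p y x"
  by (simp add: incident_def algebra_simps)

lemma polarity_graph_simps [simp]:
  "pverts (polarity_graph p) = {..<p * p}"
  "(x, y) \<in> parcs (polarity_graph p) \<longleftrightarrow> x < p * p \<and> y < p * p \<and> x \<noteq> y \<and> incident p x y"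
  "graph_order (polarity_graph p) = p * p"
  by (auto simp: polarity_graph_def graph_order_def)

lemma pair_graph_polarity: "pair_graph (polarity_graph p)"
  by (rule pair_graphI) (use incident_commute in auto)

lemma dvd_imp_eq_nat:
  fixes a b p :: nat
  assumes "int p dvd int a - int b" "a < p" "b < p" shows "a = b"
proof -
  have "int a mod int p = int b mod int p" using assms(1) by (simp add: mod_eq_dvd_iff)
  then show ?thesis using assms(2,3) by (simp add: of_nat_mod[symmetric])
qed

context
  fixes p :: nat
  assumes p: "prime p"
begin

lemma p_gt_1: "p > 1" using p by (rule prime_gt_1_nat)

lemma div_less_p: "x < p * p \<Longrightarrow> x div p < p"
  by (simp add: less_mult_imp_div_less)

lemma eq_if_div_mod: "x div p = y div p \<Longrightarrow> x mod p = y mod p \<Longrightarrow> x = (y :: nat)"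
  by (metis div_mult_mod_eq)

text \<open>There is no 4-cycle: the alternating sum of the four congruences is
  \<open>(a - a') * (c' - c)\<close>, so primality makes two first coordinates agree, and then the
  second ones agree too.\<close>

lemma incident_unique:
  assumes "x < p * p" "x' < p * p" "y < p * p" "y' < p * p" "x \<noteq> x'" "y \<noteq> y'"
    and "incident p x y" "incident p x y'" "incident p x' y" "incident p x' y'"
  shows False
proof -
  define a b a' b' c d c' d' where "a = int (x div p)" "b = int (x mod p)" "a' = int (x' div p)"
    "b' = int (x' mod p)" "c = int (y div p)" "d = int (y mod p)" "c' = int (y' div p)" "d' = int (y' mod p)"
  note defs = this
  have dvd: "int p dvd b + d - a * c" "int p dvd b + d' - a * c'"
    "int p dvd b' + d - a' * c" "int p dvd b' + d' - a' * c'"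
    using assms(7-10) by (simp_all add: incident_def defs)
  have "int p dvd ((b + d - a * c) - (b' + d - a' * c)) - ((b + d' - a * c') - (b' + d' - a' * c'))"
    by (rule dvd_diff[OF dvd_diff[OF dvd(1,3)] dvd_diff[OF dvd(2,4)]])
  also have "\<dots> = (a - a') * (c' - c)" by (simp add: algebra_simps)
  finally have "int p dvd a - a' \<or> int p dvd c' - c"
    using p by (simp add: prime_dvd_mult_iff)
  then show False
  proof
    assume "int p dvd a - a'"
    then have aa: "x div p = x' div p"
      using dvd_imp_eq_nat[of p "x div p" "x' div p"] div_less_p assms(1,2) by (simp add: defs)
    have "int p dvd (b + d - a * c) - (b' + d - a' * c)" by (rule dvd_diff[OF dvd(1,3)])
    also have "\<dots> = b - b'" using aa by (simp add: defs)
    finally have "x mod p = x' mod p"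
      using dvd_imp_eq_nat[of p "x mod p" "x' mod p"] p_gt_1 by (simp add: defs)
    then show False using eq_if_div_mod[OF aa] assms(5) by simp
  next
    assume "int p dvd c' - c"
    then have cc: "y' div p = y div p"
      using dvd_imp_eq_nat[of p "y' div p" "y div p"] div_less_p assms(3,4) by (simp add: defs)
    have "int p dvd (b + d' - a * c') - (b + d - a * c)" by (rule dvd_diff[OF dvd(2,1)])
    also have "\<dots> = d' - d" using cc by (simp add: defs)
    finally have "y' mod p = y mod p"
      using dvd_imp_eq_nat[of p "y' mod p" "y mod p"] p_gt_1 by (simp add: defs)
    then show False using eq_if_div_mod[OF cc] assms(6) by simp
  qed
qed

text \<open>For each first coordinate of \<open>y\<close> exactly one second coordinate solves the
  congruence. A self-incident \<open>x\<close> is counted as well.\<close>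

lemma incident_degree: "card {y \<in> {..<p * p}. incident p x y} = p"
proof (rule antisym)
  have "inj_on (\<lambda>y. y div p) {y \<in> {..<p * p}. incident p x y}"
  proof (rule inj_onI)
    fix y z assume y: "y \<in> {y \<in> {..<p * p}. incident p x y}" and z: "z \<in> {y \<in> {..<p * p}. incident p x y}"
      and eq: "y div p = z div p"
    have "int p dvd (int (x mod p) + int (y mod p) - int (x div p) * int (y div p)) -
      (int (x mod p) + int (z mod p) - int (x div p) * int (z div p))"
      by (rule dvd_diff) (use y z in \<open>simp_all add: incident_def\<close>)
    also have "\<dots> = int (y mod p) - int (z mod p)" using eq by simp
    finally have "y mod p = z mod p" by (rule dvd_imp_eq_nat) (use p_gt_1 in auto)
    with eq show "y = z" by (rule eq_if_div_mod)
  qed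
  then have "card {y \<in> {..<p * p}. incident p x y} \<le> card {..<p}"
    by (rule card_inj_on_le) (use div_less_p in auto)
  then show "card {y \<in> {..<p * p}. incident p x y} \<le> p" by simp
next
  define g where "g c = c * p + nat ((int (x div p) * int c - int (x mod p)) mod int p)" for c
  have p0: "int p > 0" using p_gt_1 by simp
  have lt: "nat ((int (x div p) * int c - int (x mod p)) mod int p) < p" for c
    using pos_mod_bound[OF p0] p0 by (simp add: nat_less_iff)
  have gd: "g c div p = c" and gm: "g c mod p = nat ((int (x div p) * int c - int (x mod p)) mod int p)" for c
    unfolding g_def using lt[of c] p_gt_1 by auto
  have "incident p x (g c)" for c
  proof -
    let ?z = "int (x div p) * int c - int (x mod p)"
    have "int (x mod p) + int (g c mod p) - int (x div p) * int (g c div p) = ?z mod int p - ?z"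
      unfolding gd gm using p0 by simp
    moreover have "int p dvd ?z mod int p - ?z" by (simp add: mod_eq_dvd_iff[symmetric])
    ultimately show ?thesis unfolding incident_def by (simp only:)
  qed
  moreover have "g c < p * p" if "c < p" for c
  proof -
    have "g c < c * p + p" unfolding g_def using lt[of c] by simp
    also have "\<dots> = Suc c * p" by simp
    also have "\<dots> \<le> p * p" using that by (intro mult_le_mono1) simp
    finally show ?thesis .
  qed
  ultimately have "g ` {..<p} \<subseteq> {y \<in> {..<p * p}. incident p x y}" by auto
  moreover have "inj_on g {..<p}" by (rule inj_on_inverseI[of _ "\<lambda>y. y div p"]) (rule gd)
  ultimately show "p \<le> card {y \<in> {..<p * p}. incident p x y}"
    using card_mono[of "{y \<in> {..<p * p}. incident p x y}" "g ` {..<p}"] by (simp add: card_image)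
qed

text \<open>Double counting: two points have at most one common neighbour, so by Cauchy-Schwarz the
  neighbourhoods of many points cover almost everything.\<close>

lemma non_incident_bound:
  assumes S: "S \<subseteq> {..<p * p}" and T: "T \<subseteq> {..<p * p}"
    and none: "\<And>x y. x \<in> S \<Longrightarrow> y \<in> T \<Longrightarrow> \<not> incident p x y" and ne: "S \<noteq> {}"
  shows "card T * (p + card S) \<le> p * p * p"
proof -
  let ?s = "card S"
  \<comment> \<open>All \<open>p\<close> points incident with a member of \<open>S\<close> lie in
    \<open>Z\<close>; \<open>d z\<close> below counts the members of \<open>S\<close> incident with
    \<open>z\<close>.\<close>
  define Z where "Z = {..<p * p} - T"
  have fin: "finite S" "finite Z" "finite T" using S T finite_subset unfolding Z_def by auto
  have spos: "?s > 0" using ne fin by (simp add: card_gt_0_iff)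
  define i :: "nat \<Rightarrow> nat \<Rightarrow> real" where "i x z = (if incident p x z then 1 else 0)" for x z
  define d where "d z = (\<Sum>x\<in>S. i x z)" for z
  have ii: "(\<Sum>z\<in>Z. i x z) = real (card {z \<in> Z. incident p x z})" for x
    unfolding i_def using fin by (simp add: sum.If_cases Int_def)
  have deg: "(\<Sum>z\<in>Z. i x z) = real p" if "x \<in> S" for x
  proof -
    have "{y \<in> {..<p * p}. incident p x y} = {z \<in> Z. incident p x z}"
      using none[OF that] unfolding Z_def by auto
    then show ?thesis using incident_degree[of x] unfolding ii by simp
  qed
  then have "(\<Sum>x\<in>S. \<Sum>z\<in>Z. i x z) = real ?s * real p" by simp
  moreover have "(\<Sum>z\<in>Z. d z) = (\<Sum>x\<in>S. \<Sum>z\<in>Z. i x z)" unfolding d_def by (rule sum.swap)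
  ultimately have total: "(\<Sum>z\<in>Z. d z) = real ?s * real p" by simp
  have "(\<Sum>z\<in>Z. (d z)\<^sup>2) = (\<Sum>z\<in>Z. \<Sum>x\<in>S. \<Sum>x'\<in>S. i x z * i x' z)"
    unfolding d_def power2_eq_square by (simp add: sum_product)
  also have "\<dots> = (\<Sum>x\<in>S. \<Sum>z\<in>Z. \<Sum>x'\<in>S. i x z * i x' z)" by (rule sum.swap)
  also have "\<dots> = (\<Sum>x\<in>S. \<Sum>x'\<in>S. \<Sum>z\<in>Z. i x z * i x' z)" by (intro sum.cong refl sum.swap)
  finally have squares: "(\<Sum>z\<in>Z. (d z)\<^sup>2) = (\<Sum>x\<in>S. \<Sum>x'\<in>S. \<Sum>z\<in>Z. i x z * i x' z)" .
  have common: "(\<Sum>z\<in>Z. i x z * i x' z) \<le> 1" if "x \<in> S" "x' \<in> S" "x \<noteq> x'" for x x'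
  proof -
    have "(\<Sum>z\<in>Z. i x z * i x' z) = (\<Sum>z\<in>Z. if incident p x z \<and> incident p x' z then 1 else 0)"
      unfolding i_def by (intro sum.cong) auto
    also have "\<dots> = real (card {z \<in> Z. incident p x z \<and> incident p x' z})"
      using fin by (simp add: sum.If_cases Int_def)
    also have "\<dots> \<le> 1"
    proof -
      have "card {z \<in> Z. incident p x z \<and> incident p x' z} \<le> Suc 0"
        unfolding card_le_Suc0_iff_eq[OF finite_subset[OF _ fin(2), of "{z \<in> Z. incident p x z \<and> incident p x' z}", simplified]]
        using incident_unique[of x x'] that S unfolding Z_def by blast
      then show ?thesis by simp
    qed
    finally show ?thesis .
  qed
  have "(\<Sum>z\<in>Z. i x z * i x' z) \<le> (if x' = x then real p else 0) + 1" if "x \<in> S" "x' \<in> S" for x x'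
  proof (cases "x' = x")
    case True
    have "(\<Sum>z\<in>Z. i x z * i x z) = (\<Sum>z\<in>Z. i x z)" unfolding i_def by (intro sum.cong) auto
    then show ?thesis using True deg[OF that(1)] by simp
  qed (use common that in auto)
  then have "(\<Sum>z\<in>Z. (d z)\<^sup>2) \<le> (\<Sum>x\<in>S. \<Sum>x'\<in>S. (if x' = x then real p else 0) + 1)"
    unfolding squares by (intro sum_mono) auto
  also have "\<dots> = real ?s * (real p + real ?s)"
    using fin by (simp add: sum.distrib sum.delta algebra_simps)
  \<comment> \<open>Pairs with \<open>x = x'\<close> contribute \<open>p\<close> each, the other
    ordered pairs at most 1 each.\<close>
  finally have upper: "(\<Sum>z\<in>Z. (d z)\<^sup>2) \<le> real ?s * (real p + real ?s)" .
  \<comment> \<open>By Cauchy-Schwarz, \<open>?s * p * p \<le> (p + ?s) * (p * p - card T)\<close>,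
    which rearranges to the claim.\<close>
  have "(real ?s * real p)\<^sup>2 \<le> (\<Sum>z\<in>Z. (d z)\<^sup>2) * card Z"
    using sum_squared_le_sum_of_squares[of d Z] unfolding total by simp
  also have "\<dots> \<le> real ?s * (real p + real ?s) * card Z"
    using upper by (intro mult_right_mono) auto
  finally have "real ?s * (real ?s * real p * real p) \<le> real ?s * ((real p + real ?s) * card Z)"
    by (simp add: power2_eq_square algebra_simps)
  then have "real ?s * real p * real p \<le> (real p + real ?s) * card Z"
    using spos by (simp only: mult_le_cancel_left_pos of_nat_0_less_iff)
  moreover have "real (card Z) = real p * real p - real (card T)"
  proof -
    have "card Z + card T = p * p"
      using T fin card_mono[OF _ T] unfolding Z_def by (simp add: card_Diff_subset)
    then have "real (card Z + card T) = real (p * p)" by simp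
    then show ?thesis by simp
  qed
  ultimately have "real (card T * (p + ?s)) \<le> real (p * p * p)"
    by (simp add: algebra_simps)
  then show ?thesis by (simp only: of_nat_le_iff)
qed

lemma co_connected_polarity: "co_connected (polarity_graph p)"
proof -
  let ?G = "polarity_graph p" and ?V = "{..<p * p}"
  interpret pair_graph ?G by (rule pair_graph_polarity)
  interpret c: pair_graph "complement ?G" by (rule pair_graph_complement) unfold_locales
  have pp: "0 < p * p" "1 < p * p" using p_gt_1 by (auto simp: one_less_mult)
  have step: "(x, y) \<in> rtrancl_on ?V (parcs ?G)" if "x < p * p" "y < p * p" "incident p x y" for x y
    using that by (cases "x = y") (auto intro: rtrancl_on_step)
  have "Digraph_Component.connected (with_proj ?G)"
  proof (rule connected_if_root[of 0])
    show "0 \<in> pverts ?G" using pp by simp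
    fix v assume "v \<in> pverts ?G"
    then have v: "v < p * p" by simp
    \<comment> \<open>With \<open>v\<close> as (a, b) and e = a - b modulo \<open>p\<close>,
      consecutive vertices of the walk (0, 0), (e, 0), (1, e), (a, b) are incident, possibly equal;
      \<open>e * p\<close> and \<open>p + e\<close> encode the middle ones.\<close>
    define e where "e = nat ((int (v div p) - int (v mod p)) mod int p)"
    have p0: "int p > 0" using p_gt_1 by simp
    have e: "e < p" unfolding e_def using pos_mod_bound[OF p0] p0 by (simp add: nat_less_iff)
    have inte: "int e = (int (v div p) - int (v mod p)) mod int p" unfolding e_def using p0 by simp
    have lt: "e * p < p * p" "p + e < p * p"
    proof -
      show "e * p < p * p" using e p_gt_1 by simp
      have "p + e < 2 * p" using e by simp
      also have "\<dots> \<le> p * p" using p_gt_1 by (intro mult_le_mono1) simp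
      finally show "p + e < p * p" .
    qed
    have dm: "(p + e) div p = 1" "(p + e) mod p = e" "e * p div p = e" "e * p mod p = 0"
      using e p_gt_1 by (auto simp: div_add1_eq)
    have "incident p 0 (e * p)" unfolding incident_def using dm by simp
    then have "(0, e * p) \<in> rtrancl_on ?V (parcs ?G)" using pp lt by (intro step)
    moreover have "incident p (e * p) (p + e)" unfolding incident_def dm by simp
    then have "(e * p, p + e) \<in> rtrancl_on ?V (parcs ?G)" using lt by (intro step)
    moreover have "incident p (p + e) v"
    proof -
      let ?z = "int (v div p) - int (v mod p)"
      have "int p dvd ?z mod int p - ?z" by (simp add: mod_eq_dvd_iff[symmetric])
      moreover have "int e + int (v mod p) - int 1 * int (v div p) = ?z mod int p - ?z" using inte by simp
      ultimately show ?thesis unfolding incident_def dm by (simp only:)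
    qed
    then have "(p + e, v) \<in> rtrancl_on ?V (parcs ?G)" using lt v by (intro step)
    ultimately show "(0, v) \<in> rtrancl_on (pverts ?G) (parcs ?G)"
      using rtrancl_on_trans by (metis polarity_graph_simps(1))
  qed
  moreover have "Digraph_Component.connected (with_proj (complement ?G))"
  proof (rule c.connected_if_root[of 0])
    show "0 \<in> pverts (complement ?G)" using pp by simp
    fix v assume "v \<in> pverts (complement ?G)"
    then have v: "v < p * p" by simp
    \<comment> \<open>In the complement, vertex 0 is adjacent to all points with nonzero second
      coordinate; the remaining points (a, 0) are reached through the vertex 1, which is (0,
      1).\<close>
    have root: "(0, x) \<in> rtrancl_on ?V (parcs (complement ?G))" if x: "x < p * p" "x mod p \<noteq> 0" for x
    proof (rule rtrancl_on_step)
      have "\<not> incident p 0 x"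
        unfolding incident_def using x dvd_imp_eq_nat[of p "x mod p" 0] p_gt_1 by auto
      moreover have "x \<noteq> 0" using x by (cases "x = 0") auto
      ultimately show "(0, x) \<in> parcs (complement ?G)" using x pp by auto
    qed (use x pp in auto)
    show "(0, v) \<in> rtrancl_on (pverts (complement ?G)) (parcs (complement ?G))"
    proof (cases "v = 0 \<or> v mod p \<noteq> 0")
      case True
      then show ?thesis using root[OF v] pp by auto
    next
      case False
      have "(0, 1) \<in> rtrancl_on ?V (parcs (complement ?G))" using root[of 1] pp p_gt_1 by simp
      moreover have "\<not> incident p 1 v"
        unfolding incident_def using False dvd_imp_eq_nat[of p 1 0] p_gt_1 by auto
      then have "(1, v) \<in> parcs (complement ?G)" using False v pp p_gt_1 by auto
      ultimately show ?thesis using v by (auto intro: rtrancl_on_into_rtrancl_on)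
    qed
  qed
  ultimately show ?thesis using pair_graph_polarity by (simp add: co_connected_def)
qed

text \<open>Two disjoint sets of \<open>p * m\<close> points without an edge in between contradict
  the double count, as \<open>p * m * (p + p * m) > p * p * p\<close> when
  \<open>m * m \<ge> p\<close>. If instead the complement has no edge in between, two points on each
  side form a 4-cycle.\<close>

lemma fills_in_polarity:
  assumes m: "p \<le> m * m"
  shows "fills_in (polarity_graph p) k t \<Longrightarrow> p * p \<le> k + 3 * (p * m)"
    and "fills_in (complement (polarity_graph p)) k t \<Longrightarrow> p * p \<le> k + 3 * (p * m)"
proof -
  let ?G = "polarity_graph p"
  have mpos: "m \<ge> 1" using m p_gt_1 by (cases m) auto
  have pm: "2 \<le> p * m" using mult_le_mono[of 2 p 1 m] p_gt_1 mpos by simp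
  have pair: "\<exists>x \<in> A. \<exists>y \<in> C. (x, y) \<in> parcs ?G"
    if AC: "A \<subseteq> {..<p * p}" "C \<subseteq> {..<p * p}" "A \<inter> C = {}" "p * m \<le> card A" "p * m \<le> card C" for A C
  proof (rule ccontr)
    assume none: "\<not> ?thesis"
    have "\<not> incident p x y" if "x \<in> A" "y \<in> C" for x y
    proof -
      have "x < p * p" "y < p * p" "x \<noteq> y" using AC that by auto
      then show ?thesis using none that by auto
    qed
    moreover have "A \<noteq> {}" using AC(4) pm by auto
    ultimately have "card C * (p + card A) \<le> p * p * p" by (intro non_incident_bound AC)
    moreover have "p * m * (p + p * m) \<le> card C * (p + card A)" using AC by (intro mult_le_mono add_left_mono)
    moreover have "p * p * p \<le> p * p * (m * m)" using m by (rule mult_le_mono2)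
    moreover have "p * m * (p + p * m) = p * p * m + p * p * (m * m)" by (simp add: algebra_simps)
    moreover have "0 < p * p * m" using p_gt_1 mpos by simp
    ultimately show False by linarith
  qed
  have two: "\<exists>x \<in> A. \<exists>y \<in> A. x \<noteq> y" if "p * m \<le> card A" for A :: "nat set"
  proof (rule ccontr)
    assume "\<not> ?thesis"
    moreover have "finite A" by (rule card_ge_0_finite) (use that pm in linarith)
    ultimately have "card A \<le> Suc 0" using card_le_Suc0_iff_eq by blast
    then show False using that pm by simp
  qed
  have pair': "\<exists>x \<in> A. \<exists>y \<in> C. (x, y) \<in> parcs (complement ?G)"
    if AC: "A \<subseteq> {..<p * p}" "C \<subseteq> {..<p * p}" "A \<inter> C = {}" "p * m \<le> card A" "p * m \<le> card C" for A C
  proof (rule ccontr)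
    assume none: "\<not> ?thesis"
    obtain x x' where x: "x \<in> A" "x' \<in> A" "x \<noteq> x'" using two[OF AC(4)] by blast
    obtain y y' where y: "y \<in> C" "y' \<in> C" "y \<noteq> y'" using two[OF AC(5)] by blast
    have "incident p u w" if "u \<in> A" "w \<in> C" for u w
    proof -
      have "u < p * p" "w < p * p" "u \<noteq> w" using AC that by auto
      then show ?thesis using none that by auto
    qed
    then show False using incident_unique[of x x' y y'] x y AC by auto
  qed
  have "1 \<le> p * m" using pm by linarith
  then show "p * p \<le> k + 3 * (p * m)" if "fills_in ?G k t"
    using fills_in_ge_if_no_empty_pair[OF pair_graph_polarity that, of "p * m"] pair by simp
  show "p * p \<le> k + 3 * (p * m)" if "fills_in (complement ?G) k t"
    using fills_in_ge_if_no_empty_pair[OF pair_graph_complement[OF pair_graph_polarity] that, of "p * m"]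
      \<open>1 \<le> p * m\<close> pair' by (simp del: in_parcs_complement)
qed

end


section \<open>Tight upper bounds\<close>

text \<open>\<open>D\<close> bounds how many vertices a forcing set can miss. For
  \<open>th_times\<close>, starting with fewer than \<open>n\<close> vertices costs at least
  \<open>2 * (n - D) \<ge> n\<close>.\<close>

lemma th_bounds_if_fills_in_large:
  assumes "co_connected G" "graph_order G = n" "n \<ge> 4" "\<And>k t. fills_in G k t \<Longrightarrow> n \<le> k + D"
  shows "n \<le> th_plus G + D" "n \<le> th_star G + D" "2 * D \<le> n \<Longrightarrow> th_times G = n"
proof -
  have n2: "graph_order G \<ge> 2" using assms(2,3) by simp
  note P = co_connected_parcs[OF assms(1) n2]
  obtain k t where k: "1 \<le> k" "k \<le> graph_order G" "fills_in G k t" "th_plus G = k + t"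
    using th_plus_attained[OF P(3,4)] by blast
  then show "n \<le> th_plus G + D" using assms(4)[OF k(3)] by linarith
  obtain k t where k: "1 \<le> k" "k < graph_order G" "fills_in G k t" "th_star G = k * t"
    using th_star_attained[OF P(1,2)] by blast
  have "t \<ge> 1" using fills_in_cases[OF assms(1) n2 k(3,1)] k(2) by auto
  then have "k \<le> th_star G" using k(4) by simp
  then show "n \<le> th_star G + D" using assms(4)[OF k(3)] by linarith
  obtain k t where k: "1 \<le> k" "k \<le> graph_order G" "fills_in G k t" "th_times G = k * (1 + t)"
    using th_times_attained[OF P(3,4)] by blast
  show "th_times G = n" if D: "2 * D \<le> n"
  proof -
    have "n \<le> th_times G"
    proof (cases "k = n")
      case False
      then have "t \<ge> 1" using fills_in_cases[OF assms(1) n2 k(3,1)] assms(2) by auto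
      then have "k * 2 \<le> th_times G" unfolding k(4) by (intro mult_le_mono2) simp
      then show ?thesis using assms(4)[OF k(3)] D by linarith
    qed (use k(4) in simp)
    then show ?thesis using th_times_bounds(2)[OF assms(1-3)] by simp
  qed
qed

text \<open>Tightness asks for an exact equation, so \<open>f\<close> has to be the actual gap. It
  is well defined because the family has only one graph per order.\<close>

lemma tight_minus_oI:
  fixes F :: "nat \<Rightarrow> nat pair_pre_digraph" and h :: "nat \<Rightarrow> real"
  assumes "infinite S" and inj: "inj_on (\<lambda>i. graph_order (F i)) S" and co: "\<And>i. i \<in> S \<Longrightarrow> co_connected (F i)"
    and less: "\<And>i. i \<in> S \<Longrightarrow> real (Z (F i)) < b (graph_order (F i))"
    and ge: "\<And>i. i \<in> S \<Longrightarrow> b (graph_order (F i)) - h (graph_order (F i)) \<le> real (Z (F i))"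
    and pos: "\<And>n. n \<ge> 1 \<Longrightarrow> 0 < b n" and o: "h \<in> o(b)" "(\<lambda>_. 1) \<in> o(b)"
  shows "tight_minus_o Z b"
proof -
  let ?ord = "\<lambda>i. graph_order (F i)"
  \<comment> \<open>At orders outside the family the value 1 keeps \<open>f\<close> positive; hence
    the summand 1 below and the premise that 1 is o(b).\<close>
  define f where "f n = (if n \<in> ?ord ` S then b n - real (Z (F (the_inv_into S ?ord n))) else 1)" for n
  have f: "f (?ord i) = b (?ord i) - real (Z (F i))" if "i \<in> S" for i
    using that the_inv_into_f_f[OF inj that] unfolding f_def by simp
  have fpos: "0 < f n" for n
  proof (cases "n \<in> ?ord ` S")
    case True
    then show ?thesis using f less by auto
  qed (simp add: f_def)
  have "\<bar>f n\<bar> \<le> \<bar>h n\<bar> + 1" for n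
  proof (cases "n \<in> ?ord ` S")
    case True
    then obtain i where i: "i \<in> S" "n = ?ord i" by auto
    have "f n \<le> h n" using f[OF i(1)] ge[OF i(1)] i(2) by simp
    then show ?thesis using fpos[of n] by simp
  qed (simp add: f_def)
  then have "f \<in> O(\<lambda>n. \<bar>h n\<bar> + 1)" by (intro bigoI[of _ 1]) auto
  moreover have "(\<lambda>n. \<bar>h n\<bar> + 1) \<in> o(b)" using o by (intro sum_in_smallo) auto
  ultimately have "f \<in> o(b)" by (rule landau_o.big_small_trans)
  then have "is_little_o f b" unfolding is_little_o_def using fpos pos by auto
  moreover have "infinitely_many_graphs (\<lambda>G. co_connected G \<and> real (Z G) = b (graph_order G) - f (graph_order G))"
    by (rule infinitely_many_graphsI[OF assms(1) inj]) (use co f in auto)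
  ultimately show ?thesis unfolding tight_minus_o_def by blast
qed

text \<open>The bound 64 makes \<open>sqrt p \<ge> 8\<close>, which gives
  \<open>2 * defect p \<le> p * p\<close> in \<open>two_defect_le\<close>.\<close>

definition large_primes :: "nat set" where
  "large_primes = {p. prime p \<and> 64 \<le> p}"

lemma infinite_large_primes: "infinite large_primes"
proof
  assume "finite large_primes"
  then have "finite (large_primes \<union> {..<64})" by simp
  moreover have "{p :: nat. prime p} \<subseteq> large_primes \<union> {..<64}" unfolding large_primes_def by auto
  ultimately have "finite {p :: nat. prime p}" by (rule rev_finite_subset)
  then show False using primes_infinite by simp
qed

lemma inj_on_polarity_order: "inj_on (\<lambda>p. graph_order (polarity_graph p)) S"
  by (rule inj_onI) (auto simp: square_eq_iff power2_eq_square[symmetric] power2_eq_iff_nonneg)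

text \<open>The loss \<open>3 * (p * m)\<close> of \<open>fills_in_polarity\<close> for the least
  \<open>m\<close> with \<open>m * m \<ge> p\<close>; it is of order n^(3/4) for
  \<open>n = p * p\<close>.\<close>

definition defect :: "nat \<Rightarrow> nat" where
  "defect p = 3 * (p * nat \<lceil>sqrt p\<rceil>)"

lemma defect_le: "p \<ge> 1 \<Longrightarrow> real (defect p) \<le> 6 * (real p * sqrt p)"
proof -
  assume p: "p \<ge> 1"
  then have "1 \<le> sqrt p" by simp
  have "real (nat \<lceil>sqrt p\<rceil>) \<le> sqrt p + 1" by (simp add: of_nat_nat)
  also have "\<dots> \<le> 2 * sqrt p" using \<open>1 \<le> sqrt p\<close> by simp
  finally have "real p * real (nat \<lceil>sqrt p\<rceil>) \<le> real p * (2 * sqrt p)" by (intro mult_left_mono) auto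
  then show ?thesis unfolding defect_def by simp
qed

lemma two_defect_le:
  assumes "p \<ge> 64" shows "2 * defect p \<le> p * p"
proof -
  have "sqrt 64 \<le> sqrt p" using assms by (intro real_sqrt_le_mono) simp
  moreover have "sqrt 64 = 8" by (rule real_sqrt_unique) auto
  ultimately have "8 \<le> sqrt p" by simp
  have "real (nat \<lceil>sqrt p\<rceil>) \<le> sqrt p + 1" by (simp add: of_nat_nat)
  then have "6 * real (nat \<lceil>sqrt p\<rceil>) \<le> 8 * sqrt p" using \<open>8 \<le> sqrt p\<close> by linarith
  also have "\<dots> \<le> sqrt p * sqrt p" using \<open>8 \<le> sqrt p\<close> by (intro mult_right_mono) auto
  finally have "6 * real (nat \<lceil>sqrt p\<rceil>) \<le> real p" by simp
  then have "6 * nat \<lceil>sqrt p\<rceil> \<le> p" by linarith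
  then have "p * (6 * nat \<lceil>sqrt p\<rceil>) \<le> p * p" by (rule mult_le_mono2)
  then show ?thesis unfolding defect_def by simp
qed

lemma polarity_bounds:
  assumes "p \<in> large_primes"
  defines "G \<equiv> polarity_graph p" and "n \<equiv> p * p"
  shows "n \<le> th_plus G + defect p" "n \<le> th_plus (complement G) + defect p"
    "n \<le> th_star G + defect p" "n \<le> th_star (complement G) + defect p"
    "th_times G = n" "th_times (complement G) = n"
proof -
  have p: "prime p" "64 \<le> p" using assms(1) by (auto simp: large_primes_def)
  have n4: "4 \<le> n" unfolding n_def using mult_le_mono[OF p(2) p(2)] by simp
  have "real p \<le> real (nat \<lceil>sqrt p\<rceil>) * real (nat \<lceil>sqrt p\<rceil>)"
  proof -
    have "sqrt p * sqrt p \<le> real (nat \<lceil>sqrt p\<rceil>) * real (nat \<lceil>sqrt p\<rceil>)"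
      by (intro mult_mono real_nat_ceiling_ge of_nat_0_le_iff real_sqrt_ge_zero)
    then show ?thesis by simp
  qed
  then have m: "p \<le> nat \<lceil>sqrt p\<rceil> * nat \<lceil>sqrt p\<rceil>" by (metis of_nat_le_iff of_nat_mult)
  have large: "n \<le> k + defect p" if "fills_in G k t" for k t
    using fills_in_polarity(1)[OF p(1) m] that unfolding G_def n_def defect_def by blast
  have large': "n \<le> k + defect p" if "fills_in (complement G) k t" for k t
    using fills_in_polarity(2)[OF p(1) m] that unfolding G_def n_def defect_def by blast
  have co: "co_connected G" "co_connected (complement G)"
    unfolding G_def using co_connected_polarity[OF p(1)] co_connected_complement by auto
  have ord: "graph_order G = n" "graph_order (complement G) = n" unfolding G_def n_def by auto
  have D: "2 * defect p \<le> n" unfolding n_def using p(2) by (rule two_defect_le)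
  show "n \<le> th_plus G + defect p" "n \<le> th_star G + defect p" "th_times G = n"
    using th_bounds_if_fills_in_large[OF co(1) ord(1) n4 large] D by auto
  show "n \<le> th_plus (complement G) + defect p" "n \<le> th_star (complement G) + defect p"
    "th_times (complement G) = n"
    using th_bounds_if_fills_in_large[OF co(2) ord(2) n4 large'] D by auto
qed

lemma large_primes_order:
  assumes "p \<in> large_primes"
  shows "co_connected (polarity_graph p)" "p * p \<ge> 4"
proof -
  have p: "prime p" "64 \<le> p" using assms by (auto simp: large_primes_def)
  show "p * p \<ge> 4" using mult_le_mono[OF p(2) p(2)] by simp
  show "co_connected (polarity_graph p)" using p(1) by (rule co_connected_polarity)
qed

lemma tight_sum_if:
  assumes "\<And>p. p \<in> large_primes \<Longrightarrow> ng_sum \<zeta> (polarity_graph p) < 2 * (p * p)"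
    and "\<And>p. p \<in> large_primes \<Longrightarrow> p * p \<le> \<zeta> (polarity_graph p) + defect p"
    and "\<And>p. p \<in> large_primes \<Longrightarrow> p * p \<le> \<zeta> (complement (polarity_graph p)) + defect p"
  shows "tight_minus_o (ng_sum \<zeta>) (\<lambda>n. 2 * real n)"
\<comment> \<open>\<open>h n\<close> is 12 n^(3/4); at \<open>n = p * p\<close> this is
  \<open>12 * (p * sqrt p)\<close>, twice the bound of \<open>defect_le\<close>.\<close>
proof (rule tight_minus_oI[OF infinite_large_primes inj_on_polarity_order large_primes_order(1),
    where h = "\<lambda>n. 12 * (sqrt n * sqrt (sqrt n))"])
  fix p assume p: "p \<in> large_primes"
  have "real (ng_sum \<zeta> (polarity_graph p)) < real (2 * (p * p))"
    unfolding of_nat_less_iff by (rule assms(1)[OF p])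
  then show "real (ng_sum \<zeta> (polarity_graph p)) < 2 * real (graph_order (polarity_graph p))"
    by simp
  have "real (2 * (p * p)) \<le> real (ng_sum \<zeta> (polarity_graph p) + 2 * defect p)"
    unfolding of_nat_le_iff ng_sum_def using assms(2,3)[OF p] by linarith
  moreover have "real (defect p) \<le> 6 * (real p * sqrt p)"
    using p by (intro defect_le) (simp add: large_primes_def)
  ultimately show "2 * real (graph_order (polarity_graph p)) -
      12 * (sqrt (graph_order (polarity_graph p)) * sqrt (sqrt (graph_order (polarity_graph p))))
    \<le> real (ng_sum \<zeta> (polarity_graph p))"
    by simp
next
  show "(\<lambda>n. 12 * (sqrt (real n) * sqrt (sqrt (real n)))) \<in> o(\<lambda>n. 2 * real n)" by real_asymp
  show "(\<lambda>_. 1) \<in> o(\<lambda>n. 2 * real n)" by real_asymp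
qed auto

lemma tight_prod_if:
  assumes "\<And>p. p \<in> large_primes \<Longrightarrow> ng_prod \<zeta> (polarity_graph p) < (p * p)\<^sup>2"
    and "\<And>p. p \<in> large_primes \<Longrightarrow> p * p \<le> \<zeta> (polarity_graph p) + defect p"
    and "\<And>p. p \<in> large_primes \<Longrightarrow> p * p \<le> \<zeta> (complement (polarity_graph p)) + defect p"
    and "\<And>p. p \<in> large_primes \<Longrightarrow> \<zeta> (polarity_graph p) \<le> p * p"
  shows "tight_minus_o (ng_prod \<zeta>) (\<lambda>n. real n ^ 2)"
proof (rule tight_minus_oI[OF infinite_large_primes inj_on_polarity_order large_primes_order(1),
    where h = "\<lambda>n. 12 * (real n * (sqrt n * sqrt (sqrt n)))"])
  fix p assume p: "p \<in> large_primes"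
  have "real (ng_prod \<zeta> (polarity_graph p)) < real ((p * p)\<^sup>2)"
    unfolding of_nat_less_iff by (rule assms(1)[OF p])
  then show "real (ng_prod \<zeta> (polarity_graph p)) < real (graph_order (polarity_graph p)) ^ 2"
    by simp
  define n x y D where "n = p * p" "x = \<zeta> (polarity_graph p)" "y = \<zeta> (complement (polarity_graph p))" "D = defect p"
  note defs = this
  have xy: "n \<le> x + D" "n \<le> y + D" "x \<le> n" using assms(2-4)[OF p] unfolding defs by auto
  \<comment> \<open>The chain shows that the product falls short of \<open>n * n\<close> by at most
    \<open>2 * n * D\<close>, stated without subtraction of naturals.\<close>
  have "n * n \<le> n * (x + D)" using xy(1) by (rule mult_le_mono2)
  also have "\<dots> = x * n + n * D" by (simp add: algebra_simps)
  also have "\<dots> \<le> x * (y + D) + n * D" using xy(2) by (intro add_right_mono mult_le_mono2)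
  also have "\<dots> \<le> x * y + n * D + n * D" using mult_le_mono1[OF xy(3), of D] by (simp add: algebra_simps)
  finally have "real (n * n) \<le> real (x * y + n * D + n * D)" unfolding of_nat_le_iff .
  then have "real n * real n - 2 * (real n * real D) \<le> real x * real y" by (simp add: algebra_simps)
  moreover have "real n * real D \<le> real n * (6 * (real p * sqrt p))"
    unfolding defs using p by (intro mult_left_mono defect_le) (auto simp: large_primes_def)
  ultimately have "real n * real n - 12 * (real n * (real p * sqrt p)) \<le> real x * real y" by simp
  then show "real (graph_order (polarity_graph p)) ^ 2 -
      12 * (real (graph_order (polarity_graph p)) * (sqrt (graph_order (polarity_graph p)) *
        sqrt (sqrt (graph_order (polarity_graph p)))))
    \<le> real (ng_prod \<zeta> (polarity_graph p))"
    unfolding ng_prod_def defs by (simp add: power2_eq_square)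
next
  show "(\<lambda>n. 12 * (real n * (sqrt (real n) * sqrt (sqrt (real n))))) \<in> o(\<lambda>n. real n ^ 2)" by real_asymp
  show "(\<lambda>_. 1) \<in> o(\<lambda>n. real n ^ 2)" by real_asymp
qed auto

lemma tight_polarity:
  "tight_minus_o (ng_sum th_plus) (\<lambda>n. 2 * real n)"
  "tight_minus_o (ng_prod th_plus) (\<lambda>n. real n ^ 2)"
  "tight_minus_o (ng_sum th_star) (\<lambda>n. 2 * real n)"
  "tight_minus_o (ng_prod th_star) (\<lambda>n. real n ^ 2)"
proof -
  have order: "co_connected (polarity_graph p)" "graph_order (polarity_graph p) = p * p" "p * p \<ge> 4"
    if "p \<in> large_primes" for p using large_primes_order[OF that] by auto
  show "tight_minus_o (ng_sum th_plus) (\<lambda>n. 2 * real n)"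
  proof (rule tight_sum_if)
    show "ng_sum th_plus (polarity_graph p) < 2 * (p * p)" if "p \<in> large_primes" for p
      using ng_sum_th_plus(2)[OF order[OF that]] by linarith
  qed (simp_all add: polarity_bounds)
  show "tight_minus_o (ng_sum th_star) (\<lambda>n. 2 * real n)"
  proof (rule tight_sum_if)
    show "ng_sum th_star (polarity_graph p) < 2 * (p * p)" if "p \<in> large_primes" for p
      using ng_sum_th_star(2)[OF order[OF that]] by linarith
  qed (simp_all add: polarity_bounds)
  show "tight_minus_o (ng_prod th_plus) (\<lambda>n. real n ^ 2)"
  proof (rule tight_prod_if)
    fix p assume p: "p \<in> large_primes"
    have "(p * p - 1)\<^sup>2 < (p * p)\<^sup>2" using order(3)[OF p] by (intro power_strict_mono) auto
    then show "ng_prod th_plus (polarity_graph p) < (p * p)\<^sup>2"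
      using ng_prod_th_plus_upper[OF order[OF p]] by linarith
    show "th_plus (polarity_graph p) \<le> p * p" using th_plus_bounds(2)[OF order[OF p]] by linarith
  qed (simp_all add: polarity_bounds)
  show "tight_minus_o (ng_prod th_star) (\<lambda>n. real n ^ 2)"
  proof (rule tight_prod_if)
    fix p assume p: "p \<in> large_primes"
    have "(p * p - 2)\<^sup>2 < (p * p)\<^sup>2" using order(3)[OF p] by (intro power_strict_mono) auto
    then show "ng_prod th_star (polarity_graph p) < (p * p)\<^sup>2"
      using ng_prod_th_star_upper[OF order[OF p]] by linarith
    show "th_star (polarity_graph p) \<le> p * p" using th_star_bounds(2)[OF order[OF p]] by linarith
  qed (simp_all add: polarity_bounds)
qed

lemma sharp_polarity:
  "sharp (ng_sum th_times) (\<lambda>n. 2 * int n)" "sharp (ng_prod th_times) (\<lambda>n. int n ^ 2)"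
  unfolding sharp_def ng_sum_def ng_prod_def
  by (rule infinitely_many_graphsI[OF infinite_large_primes inj_on_polarity_order],
      simp add: polarity_bounds large_primes_order(1) power2_eq_square)+

lemma le_square_minus_1_if_le_square:
  fixes \<zeta> :: nat
  assumes "\<zeta> \<le> m\<^sup>2" "m < n" shows "real \<zeta> \<le> real n ^ 2 - 1"
proof -
  have "m\<^sup>2 < n\<^sup>2" using assms(2) by (intro power_strict_mono) auto
  then have "real (\<zeta> + 1) \<le> real (n\<^sup>2)" unfolding of_nat_le_iff using assms(1) by linarith
  then show ?thesis by simp
qed

theorem corollary3p8:
  shows
    "(\<exists>f. is_little_o f (\<lambda>n. real n) \<and>
        (\<forall>(G :: 'a pair_pre_digraph) n. co_connected G \<and> graph_order G = n \<and> n \<ge> 4 \<longrightarrow>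
           n \<le> ng_sum th_plus G \<and>
           real (ng_sum th_plus G) \<le> 2 * real n - f n)) \<and>
     (\<exists>f. is_little_o f (\<lambda>n. real n ^ 2) \<and>
        (\<forall>(G :: 'a pair_pre_digraph) n. co_connected G \<and> graph_order G = n \<and> n \<ge> 4 \<and> n \<noteq> 5 \<longrightarrow>
           max (2 * int n) (3 * int n - 9) \<le> int (ng_prod th_plus G) \<and>
           real (ng_prod th_plus G) \<le> real n ^ 2 - f n)) \<and>
     (\<forall>G :: 'a pair_pre_digraph. co_connected G \<and> graph_order G = 5 \<longrightarrow>
        9 \<le> ng_prod th_plus G \<and> ng_prod th_plus G \<le> 12) \<and>
     (\<exists>f. is_little_o f (\<lambda>n. real n) \<and>
        (\<forall>(G :: 'a pair_pre_digraph) n. co_connected G \<and> graph_order G = n \<and> n \<ge> 4 \<longrightarrow>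
           int n - 2 \<le> int (ng_sum th_star G) \<and>
           real (ng_sum th_star G) \<le> 2 * real n - f n)) \<and>
     (\<exists>f. is_little_o f (\<lambda>n. real n ^ 2) \<and>
        (\<forall>(G :: 'a pair_pre_digraph) n. co_connected G \<and> graph_order G = n \<and> n \<ge> 4 \<longrightarrow>
           max (int n - 1) (2 * int n - 8) \<le> int (ng_prod th_star G) \<and>
           real (ng_prod th_star G) \<le> real n ^ 2 - f n)) \<and>
     (\<forall>(G :: 'a pair_pre_digraph) n. co_connected G \<and> graph_order G = n \<and> n \<ge> 4 \<longrightarrow>
        n \<le> ng_sum th_times G \<and> ng_sum th_times G \<le> 2 * n \<and>
        (n \<ge> 6 \<longrightarrow> 3 * n \<le> ng_prod th_times G \<and> ng_prod th_times G \<le> n ^ 2) \<and>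
        (n = 4 \<longrightarrow> ng_prod th_times G = 9) \<and>
        (n = 5 \<longrightarrow> 12 \<le> ng_prod th_times G \<and> ng_prod th_times G \<le> 20)) \<and>
     tight_minus_o (ng_sum th_plus) (\<lambda>n. 2 * real n) \<and>
     tight_minus_o (ng_prod th_plus) (\<lambda>n. real n ^ 2) \<and>
     almost_sharp (ng_sum th_plus) (\<lambda>n. int n) \<and>
     almost_sharp (ng_prod th_plus) (\<lambda>n. max (2 * int n) (3 * int n - 9)) \<and>
     tight_minus_o (ng_sum th_star) (\<lambda>n. 2 * real n) \<and>
     tight_minus_o (ng_prod th_star) (\<lambda>n. real n ^ 2) \<and>
     almost_sharp (ng_sum th_star) (\<lambda>n. int n - 2) \<and>
     almost_sharp (ng_prod th_star) (\<lambda>n. max (int n - 1) (2 * int n - 8)) \<and>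
     sharp (ng_sum th_times) (\<lambda>n. 2 * int n) \<and>
     sharp (ng_prod th_times) (\<lambda>n. int n ^ 2) \<and>
     sharp (ng_prod th_times) (\<lambda>n. 3 * int n) \<and>
     almost_sharp (ng_sum th_times) (\<lambda>n. int n)"
proof (intro conjI tight_polarity almost_sharp_brooms sharp_brooms sharp_polarity,
    goal_cases plus_sum plus_prod plus_5 star_sum star_prod times)
  case plus_sum
  show ?case
  proof (intro exI[of _ "\<lambda>_. 1"] conjI is_little_o_1 allI impI; elim conjE)
    fix G :: "'a pair_pre_digraph" and n
    assume G: "co_connected G" "graph_order G = n" "4 \<le> n"
    show "n \<le> ng_sum th_plus G" using ng_sum_th_plus(1)[OF G] .
    have "real (ng_sum th_plus G + 2) \<le> real (2 * n)" unfolding of_nat_le_iff by (rule ng_sum_th_plus(2)[OF G])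
    then show "real (ng_sum th_plus G) \<le> 2 * real n - 1" by simp
  qed
next
  case plus_prod
  show ?case
  proof (intro exI[of _ "\<lambda>_. 1"] conjI is_little_o_1 allI impI; elim conjE)
    fix G :: "'a pair_pre_digraph" and n
    assume G: "co_connected G" "graph_order G = n" "4 \<le> n" and "n \<noteq> 5"
    then show "max (2 * int n) (3 * int n - 9) \<le> int (ng_prod th_plus G)"
      using ng_prod_th_plus_lower(2)[OF G] by linarith
    show "real (ng_prod th_plus G) \<le> real n ^ 2 - 1"
      using ng_prod_th_plus_upper[OF G] by (rule le_square_minus_1_if_le_square) (use G(3) in simp)
  qed
next
  case plus_5
  show ?case
  proof (intro allI impI; elim conjE)
    fix G :: "'a pair_pre_digraph" assume G: "co_connected G" "graph_order G = 5"
    then show "9 \<le> ng_prod th_plus G \<and> ng_prod th_plus G \<le> 12"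
      using ng_prod_th_plus_lower(1)[OF G] order_5_upper(1)[OF G] by simp
  qed
next
  case star_sum
  show ?case
  proof (intro exI[of _ "\<lambda>_. 1"] conjI is_little_o_1 allI impI; elim conjE)
    fix G :: "'a pair_pre_digraph" and n
    assume G: "co_connected G" "graph_order G = n" "4 \<le> n"
    show "int n - 2 \<le> int (ng_sum th_star G)" using ng_sum_th_star(1)[OF G] by linarith
    have "real (ng_sum th_star G + 4) \<le> real (2 * n)" unfolding of_nat_le_iff by (rule ng_sum_th_star(2)[OF G])
    then show "real (ng_sum th_star G) \<le> 2 * real n - 1" by simp
  qed
next
  case star_prod
  show ?case
  proof (intro exI[of _ "\<lambda>_. 1"] conjI is_little_o_1 allI impI; elim conjE)
    fix G :: "'a pair_pre_digraph" and n
    assume G: "co_connected G" "graph_order G = n" "4 \<le> n"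
    show "max (int n - 1) (2 * int n - 8) \<le> int (ng_prod th_star G)"
      using ng_prod_th_star_lower[OF G] by linarith
    show "real (ng_prod th_star G) \<le> real n ^ 2 - 1"
      using ng_prod_th_star_upper[OF G] by (rule le_square_minus_1_if_le_square) (use G(3) in simp)
  qed
next
  case times
  show ?case
  proof (intro allI impI; elim conjE)
    fix G :: "'a pair_pre_digraph" and n
    assume G: "co_connected G" "graph_order G = n" "4 \<le> n"
    show "n \<le> ng_sum th_times G \<and> ng_sum th_times G \<le> 2 * n \<and>
        (n \<ge> 6 \<longrightarrow> 3 * n \<le> ng_prod th_times G \<and> ng_prod th_times G \<le> n ^ 2) \<and>
        (n = 4 \<longrightarrow> ng_prod th_times G = 9) \<and>
        (n = 5 \<longrightarrow> 12 \<le> ng_prod th_times G \<and> ng_prod th_times G \<le> 20)"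
      using ng_sum_th_times[OF G] ng_prod_th_times_lower[OF G] ng_prod_th_times_upper[OF G]
        order_4_ng_prod_th_times[OF G] order_5_upper(2)[OF G] by blast
  qed
qed

end
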